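(* For a binary sequence $X_1,X_2,\dots$ and $t\ge1$ define $$R_t:=\frac{\Gamma\left(n_{0|0}+\tfrac12\right)\Gamma\left(n_{0|1}+\tfrac12\right)\Gamma\left(n_{1|0}+\tfrac12\right)\Gamma\left(n_{1|1}+\tfrac12\right)}{2\,\Gamma\left(\tfrac12\right)^4\,\Gamma(n_{0|0}+n_{1|0}+1)\,\Gamma(n_{0|1}+n_{1|1}+1)}\Big/\left(\left(\frac{n_1}{t}\right)^{n_1}\left(\frac{n_0}{t}\right)^{n_0}\right),$$ and $R_0:=1$. For any data sequence, if the limits $$\alpha:=\lim_{t\to\infty}\frac{n_{1|1}}{t},\quad \beta:=\lim_{t\to\infty}\frac{n_{0|0}}{t},\quad \gamma:=\lim_{t\to\infty}\frac{n_{1|0}}{t}=\lim_{t\to\infty}\frac{n_{0|1}}{t},\quad p:=\lim_{t\to\infty}\frac{n_1}{t}=\lim_{t\to\infty}\frac{n_{1|1}+n_{0|1}}{t}$$ exist, then $\lim_{t\to\infty}\frac{\ln R_t}{t}=r^*$, where $$\begin{aligned} r^*&:=p\left(\ln\frac1p-p_{0|1}\ln\frac1{p_{1|0}}-p_{1|1}\ln\frac1{p_{1|1}}\right)+(1-p)\left(\ln\frac1{1-p}-p_{0|0}\ln\frac1{p_{0|0}}-p_{1|0}\ln\frac1{p_{0|1}}\right)\\&=\gamma\ln\frac{\gamma}{1-p}+\beta\ln\frac{\beta}{1-p}+\alpha\ln\frac{\alpha}{p}+\gamma\ln\frac{\gamma}{p}-p\ln p-(1-p)\ln(1-p).\end{aligned}$$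 (The second expression is a difference of entropies of Bernoulli and first-order Markov sources with the corresponding parameters: it equals $h(p)-p\,h(p_{1|1})-(1-p)\,h(p_{1|0})$ with $h(x)=-x\ln x-(1-x)\ln(1-x)$.) Furthermore, if $\alpha(1-p)\ne\gamma p$, then $r^*>0$, that is, $(R_t)$ increases to infinity exponentially fast. In fact, $r^*=0$ if and only if $\alpha(1-p)=\gamma p$. Finally, whenever the exchangeability null is true (i.e. under every $\mathtt{Q}\in\overline{\mathcal{Q}}$), $\lim_{t\to\infty}R_t=0$ almost surely, in addition to $(R_t)$ being a $\overline{\mathcal{Q}}$-safe e-process.
   Context: The data $(X_t)_{t\ge1}$ are the coordinates on $\{0,1\}^{\mathbb{N}}$; $\mathcal{F}_0$ is trivial and $\mathcal{F}_t=\sigma(X_1,\dots,X_t)$. $\Gamma$ is the gamma function. $n_0=n_0(t)$ and $n_1=n_1(t)$ are the numbers of zeros and ones among $X_1,\dots,X_t$; $n_{j|i}=n_{j|i}(t)$ is the number of $s\in\{2,\dots,t\}$ with $X_{s-1}=i$ and $X_s=j$. Since $n_{1|0}$ and $n_{0|1}$ differ by at most one, and $n_1$ and $n_{1|1}+n_{0|1}$ differ by at most one, the two expressions for $\gamma$, and those for $p$, agree. Given the limits, define $p_{1|1}:=\alpha/p$, $p_{0|1}:=\gamma/p$, $p_{1|0}:=\gamma/(1-p)$, $p_{0|0}:=\beta/(1-p)$, with the convention $0/0:=1$. Further conventions: $0^0:=1$; any term of the form $0\cdot\ln(\cdot)$ is $0$; and in the first expression for $r^*$ the first summand is $0$ when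 $p=0$ and the second summand is $0$ when $p=1$. $\overline{\mathcal{Q}}$ is the set of all exchangeable laws on $\{0,1\}^{\mathbb{N}}$, i.e. those for which $(X_1,\dots,X_t)$ and $(X_{\sigma(1)},\dots,X_{\sigma(t)})$ have the same law for every $t$ and every permutation $\sigma$ of $\{1,\dots,t\}$. A $\overline{\mathcal{Q}}$-safe e-process is a nonnegative adapted process $(E_t)_{t\ge0}$ with $\sup_{\mathtt{Q}\in\overline{\mathcal{Q}}}\sup_\tau\mathbb{E}_{\mathtt{Q}}[E_\tau]\le1$, where $\tau$ ranges over all, possibly infinite, stopping times and $E_\infty:=\limsup_{t\to\infty}E_t$. *)

theory Defs
  imports "HOL-Probability.Probability" "HOL-Library.Extended_Nat"
begin

text \<open>
  A binary sequence is a function of type \<^typ>\<open>nat \<Rightarrow> bool\<close> read at the positive indices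
  \<open>1, 2, \<dots>\<close>; \<^term>\<open>True\<close> stands for the symbol 1 and \<^term>\<open>False\<close> for the symbol 0.
\<close>

definition symbol_count :: "bool \<Rightarrow> nat \<Rightarrow> (nat \<Rightarrow> bool) \<Rightarrow> nat" where
  "symbol_count j t x = card {s \<in> {1..t}. x s = j}"

text \<open>\<open>trans_count j i t x\<close> is $n_{j|i}(t)$: the later symbol comes first.\<close>

definition trans_count :: "bool \<Rightarrow> bool \<Rightarrow> nat \<Rightarrow> (nat \<Rightarrow> bool) \<Rightarrow> nat" where
  "trans_count j i t x = card {s \<in> {2..t}. x (s - 1) = i \<and> x s = j}"

text \<open>The powers have natural exponents, so that \<open>0 ^ 0 = 1\<close>.\<close>

definition R :: "nat \<Rightarrow> (nat \<Rightarrow> bool) \<Rightarrow> real" where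
  "R t x = (if t = 0 then 1 else
     (let n0  = symbol_count False t x;
          n1  = symbol_count True t x;
          n00 = real (trans_count False False t x);
          n01 = real (trans_count False True t x);
          n10 = real (trans_count True False t x);
          n11 = real (trans_count True True t x)
      in (Gamma (n00 + 1/2) * Gamma (n01 + 1/2) * Gamma (n10 + 1/2) * Gamma (n11 + 1/2)
           / (2 * Gamma (1/2) ^ 4 * Gamma (n00 + n10 + 1) * Gamma (n01 + n11 + 1)))
         / ((real n1 / real t) ^ n1 * (real n0 / real t) ^ n0)))"

text \<open>Division with the convention \<open>0/0 = 1\<close>.\<close>

definition ratio :: "real \<Rightarrow> real \<Rightarrow> real" where
  "ratio a b = (if a = 0 \<and> b = 0 then 1 else a / b)"

text \<open>
  The convention that a term \<open>0 \<cdot> ln(\<cdot>)\<close> is \<open>0\<close> holds automatically, because \<^term>\<open>ln\<close>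
  and division are total.
\<close>

definition rstar :: "real \<Rightarrow> real \<Rightarrow> real \<Rightarrow> real \<Rightarrow> real" where
  "rstar \<alpha> \<beta> \<gamma> p =
     (let p11 = ratio \<alpha> p; p01 = ratio \<gamma> p;
          p10 = ratio \<gamma> (1 - p); p00 = ratio \<beta> (1 - p)
      in (if p = 0 then 0
          else p * (ln (1 / p) - p01 * ln (1 / p10) - p11 * ln (1 / p11)))
       + (if p = 1 then 0
          else (1 - p) * (ln (1 / (1 - p)) - p00 * ln (1 / p00) - p10 * ln (1 / p01))))"

definition bernoulli_entropy :: "real \<Rightarrow> real" where
  "bernoulli_entropy x = - x * ln x - (1 - x) * ln (1 - x)"

definition seq_space :: "(nat \<Rightarrow> bool) measure" where
  "seq_space = (\<Pi>\<^sub>M s\<in>{1..}. count_space UNIV)"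

text \<open>
  The index set is \<^typ>\<open>enat\<close> because stopping times may be infinite: at a finite \<open>t\<close> this is
  the \<open>\<sigma>\<close>-algebra generated by the first \<open>t\<close> coordinates (trivial for \<open>t = 0\<close>), and at
  \<open>\<infinity>\<close> it is generated by all coordinates.  The condition in \<^const>\<open>stopping_time\<close> at
  \<open>\<infinity>\<close> is vacuous.
\<close>

definition nat_filt :: "enat \<Rightarrow> (nat \<Rightarrow> bool) measure" where
  "nat_filt t = sigma (space seq_space)
     {{\<omega> \<in> space seq_space. \<omega> s \<in> A} | s A. 1 \<le> s \<and> enat s \<le> t}"

definition exchangeable_laws :: "(nat \<Rightarrow> bool) measure set" where
  "exchangeable_laws = {Q. prob_space Q \<and> sets Q = sets seq_space \<and>
     (\<forall>t \<sigma>. \<sigma> permutes {1..t} \<longrightarrow>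
        distr Q (\<Pi>\<^sub>M s\<in>{1..t}. count_space UNIV) (\<lambda>\<omega>. \<lambda>s\<in>{1..t}. \<omega> s)
      = distr Q (\<Pi>\<^sub>M s\<in>{1..t}. count_space UNIV) (\<lambda>\<omega>. \<lambda>s\<in>{1..t}. \<omega> (\<sigma> s)))}"

definition stopped ::
    "(nat \<Rightarrow> (nat \<Rightarrow> bool) \<Rightarrow> real) \<Rightarrow> ((nat \<Rightarrow> bool) \<Rightarrow> enat) \<Rightarrow> (nat \<Rightarrow> bool) \<Rightarrow> ennreal" where
  "stopped E \<tau> \<omega> = (case \<tau> \<omega> of
     enat t \<Rightarrow> ennreal (E t \<omega>)
   | \<infinity> \<Rightarrow> limsup (\<lambda>t. ennreal (E t \<omega>)))"

definition safe_e_process ::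
    "(nat \<Rightarrow> bool) measure set \<Rightarrow> (nat \<Rightarrow> (nat \<Rightarrow> bool) \<Rightarrow> real) \<Rightarrow> bool" where
  "safe_e_process \<Q> E \<longleftrightarrow>
     (\<forall>t. \<forall>\<omega> \<in> space seq_space. 0 \<le> E t \<omega>) \<and>
     (\<forall>t. E t \<in> borel_measurable (nat_filt (enat t))) \<and>
     (SUP Q\<in>\<Q>. SUP \<tau>\<in>{\<tau>. stopping_time nat_filt \<tau>}. \<integral>\<^sup>+ \<omega>. stopped E \<tau> \<omega> \<partial>Q) \<le> 1"

end

theory Submission
  imports Defs
begin

text \<open>
  Write \<open>R t = U t / L t\<close>, where \<open>L t\<close> is the maximum likelihood of the data over Bernoulli sources and
  \<open>U t\<close> is the Krichevsky-Trofimov mixture over first-order Markov chains.  By Stirling bounds, each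
  Krichevsky-Trofimov factor agrees with its maximum likelihood up to a factor of order
  \<open>\<surd>n\<close>, so \<open>ln R t / t\<close> converges to the mutual information of two consecutive symbols.

  Under an exchangeable law, the probability of a word is at most \<open>L t\<close> (sample the word from a much
  longer one; de Finetti's theorem is not needed).  Hence the expectation of \<open>R\<close> at a finite stopping
  time is at most the \<open>U\<close>-mass of the stopped words.  For \<open>R t \<rightarrow> 0\<close>, consider at one large time \<open>T\<close> the
  words that are constant, or in which both symbols are frequent and the number of pairs 11 deviates by
  \<open>O(\<surd>T)\<close> from its value under independence.  Exchangeable laws give such words almost all their mass.
  On the non-constant ones \<open>U T\<close> is \<open>O(T\<^sup>-\<^sup>1\<^sup>/\<^sup>2)\<close> times the Bernoulli mixture, so
  their \<open>U\<close>-mass is small, and with it the probability that \<open>R\<close> ever exceeds \<open>\<epsilon>\<close> after \<open>T\<close>.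
  In particular infinite stopping times contribute nothing.
\<close>

section \<open>Krichevsky-Trofimov probabilities and maximum likelihood\<close>

text \<open>The denominator of \<open>R\<close> is not a probability: the maximum likelihoods of all
  words of one length sum to more than 1. So \<open>R\<close> is no supermartingale under the null
  (for a fair coin its mean rises from 1/2 at time 1 to 5/8 at time 2), and domination by
  \<open>U\<close> alone bounds the probability of ever reaching a level \<epsilon> only by
  1/\<epsilon>. The missing smallness comes from counting parameters. Mixing over one unknown
  probability costs a factor of order t^(-1/2). The Markov mixture has two such parameters and pays
  1/t, the Bernoulli mixture has one. On words that look independent both families fit equally well
  up to a constant, so the second parameter is a net loss. The comparison degenerates when one
  symbol is rare, and an exchangeable law may put mass at or near the frequencies 0 and 1. Hence no
  frequency threshold \<kappa> serves all laws: \<kappa> and the time \<open>T\<close> are chosen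
  after the law, and constant words are treated separately. Everything happens in finite sums over
  words, so the mixtures never have to be extended to measures.\<close>

definition kt_prob :: "nat \<Rightarrow> nat \<Rightarrow> real" where
  "kt_prob a b = pochhammer (1/2) a * pochhammer (1/2) b / fact (a + b)"

definition max_lik :: "nat \<Rightarrow> nat \<Rightarrow> real" where
  "max_lik a b = (real a / real (a + b)) ^ a * (real b / real (a + b)) ^ b"

text \<open>The logarithm of n! / (n^(n+1/2) e^(-n)), whose limit is ln sqrt(2 pi), about
  0.919.\<close>

definition stirling_gap :: "nat \<Rightarrow> real" where
  "stirling_gap n = ln (fact n) - (real n + 1/2) * ln (real n) + real n"

text \<open>The decrease is (n + 1/2)(ln(n+1) - ln n) - 1. Since 1/x is convex, the trapezoid rule
  overestimates the integral ln(n+1) - ln n and the midpoint rule underestimates it; the first gives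
  the size of the decrease, the second its sign.\<close>

lemma stirling_gap_step:
  assumes "n \<ge> 1"
  shows "stirling_gap (Suc n) \<le> stirling_gap n"
    and "stirling_gap n - stirling_gap (Suc n) \<le> (1 / real n - 1 / real (Suc n)) / 4"
proof -
  have n: "real n > 0" using assms by simp
  have gap: "stirling_gap n - stirling_gap (Suc n) = (real n + 1/2) * (ln (real n + 1) - ln (real n)) - 1"
  proof -
    have "ln (fact (Suc n) :: real) = ln (real n + 1) + ln (fact n)"
      using ln_mult[of "real n + 1" "fact n :: real"] by (simp add: add.commute)
    then show ?thesis by (simp add: stirling_gap_def algebra_simps del: fact_Suc)
  qed
  have "ln (real n + 1) - ln (real n) \<le> 1 * (inverse (real n) + inverse (real n + 1)) / 2"
    by (rule ln_inverse_approx_le) (use n in auto)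
  then have "(real n + 1/2) * (ln (real n + 1) - ln (real n))
      \<le> (real n + 1/2) * (1 * (inverse (real n) + inverse (real n + 1)) / 2)"
    using n by (intro mult_left_mono) auto
  also have "\<dots> = 1 + (1 / real n - 1 / real (Suc n)) / 4"
    using n by (simp add: divide_simps) (simp add: algebra_simps)
  finally show "stirling_gap n - stirling_gap (Suc n) \<le> (1 / real n - 1 / real (Suc n)) / 4"
    unfolding gap by (metis add.commute diff_le_eq)
  have "ln (real n + 1) - ln (real n) \<ge> 2 / (2 * real n + 1)"
    using ln_inverse_approx_ge[of "real n" "real n + 1"] n by simp
  then have "(real n + 1/2) * (2 / (2 * real n + 1)) \<le> (real n + 1/2) * (ln (real n + 1) - ln (real n))"
    using n by (intro mult_left_mono) auto
  moreover have "(real n + 1/2) * (2 / (2 * real n + 1)) = 1"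
    using n by (simp add: field_simps)
  ultimately show "stirling_gap (Suc n) \<le> stirling_gap n"
    using gap by linarith
qed

lemma stirling_gap_bounds:
  assumes "n \<ge> 1"
  shows "3/4 \<le> stirling_gap n" "stirling_gap n \<le> 1"
proof -
  \<comment> \<open>The value at 1 is 1 and the decreases telescope to at most 1/4 in total. The
    summand 1/(4n) is the part that later steps may still use up.\<close>
  have "stirling_gap n \<le> 1 \<and> 3/4 + 1 / real n / 4 \<le> stirling_gap n"
    using assms
  proof (induction n rule: nat_induct_at_least)
    case base
    then show ?case by (simp add: stirling_gap_def)
  next
    case (Suc n)
    have "stirling_gap n - stirling_gap (Suc n) \<le> 1 / real n / 4 - 1 / real (Suc n) / 4"
      using stirling_gap_step(2)[OF Suc.hyps] by (simp only: diff_divide_distrib)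
    then show ?case
      using stirling_gap_step(1)[OF Suc.hyps] Suc.IH by argo
  qed
  moreover have "1 / real n / 4 \<ge> 0" by simp
  ultimately show "3/4 \<le> stirling_gap n" "stirling_gap n \<le> 1" by linarith+
qed

lemma stirling_gap_antimono:
  assumes "1 \<le> m" "m \<le> n"
  shows "stirling_gap n \<le> stirling_gap m"
  using assms(2)
proof (induction n rule: dec_induct)
  case (step n)
  then show ?case using stirling_gap_step(1)[of n] assms(1) by simp
qed simp

lemma pochhammer_half_pos: "pochhammer (1/2 :: real) a > 0"
  by (simp add: pochhammer_pos)

text \<open>In the duplication formula (2a)! = 4^a (1/2)_a a! the square roots from the two Stirling
  formulas cancel, so no logarithmic term remains. The error is
  \<open>stirling_gap (2 * a) - stirling_gap a + ln 2 / 2\<close>, whose difference lies in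
  [-1/4, 0] and whose last term lies in [0, 1/2].\<close>

lemma ln_pochhammer_half_bounds:
  fixes a :: nat
  defines "r \<equiv> ln (pochhammer (1/2 :: real) a) - (real a * ln (real a) - real a)"
  shows "- 1/4 \<le> r" "r \<le> 1/2"
proof -
  have "- 1/4 \<le> r \<and> r \<le> 1/2"
  proof (cases "a = 0")
    case True
    then show ?thesis by (simp add: r_def)
  next
    case False
    then have a: "real a > 0" "a \<ge> 1" by auto
    have "fact (2 * a) = (2 ^ (2 * a) * pochhammer (1/2) a * fact a :: real)"
      by (rule fact_double)
    then have "ln (fact (2 * a) :: real) = ln (2 ^ (2 * a)) + ln (pochhammer (1/2) a) + ln (fact a)"
      using pochhammer_half_pos[of a] by (simp add: ln_mult)
    then have "r = stirling_gap (2 * a) - stirling_gap a + ln 2 / 2"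
      using a by (simp add: r_def stirling_gap_def ln_mult ln_realpow algebra_simps)
    moreover have "stirling_gap (2 * a) \<le> stirling_gap a"
      using a by (intro stirling_gap_antimono) auto
    moreover have "stirling_gap (2 * a) \<ge> 3/4" "stirling_gap a \<le> 1"
      using stirling_gap_bounds(1)[of "2 * a"] stirling_gap_bounds(2)[of a] a by auto
    moreover have "0 \<le> ln (2::real)" "ln (2::real) \<le> 1"
      using ln_le_minus_one[of "2::real"] by auto
    ultimately show ?thesis by linarith
  qed
  then show "- 1/4 \<le> r" "r \<le> 1/2" by auto
qed

text \<open>The term \<open>ln (real n + 1)\<close> instead of Stirling's \<open>ln (real n)\<close>
  admits n = 0 and costs at most 1/2.\<close>

lemma ln_fact_bounds:
  fixes n :: nat
  defines "r \<equiv> ln (fact n :: real) - (real n * ln (real n) - real n + ln (real n + 1) / 2)"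
  shows "0 \<le> r" "r \<le> 1"
proof -
  have "0 \<le> r \<and> r \<le> 1"
  proof (cases "n = 0")
    case True
    then show ?thesis by (simp add: r_def)
  next
    case False
    then have n: "n \<ge> 1" "real n > 0" by auto
    have r: "r = stirling_gap n - (ln (real n + 1) - ln (real n)) / 2"
      by (simp add: r_def stirling_gap_def field_simps)
    have "ln (real n + 1) - ln (real n) = ln ((real n + 1) / real n)"
      using n by (simp add: ln_div)
    also have "\<dots> \<le> (real n + 1) / real n - 1"
      using n by (intro ln_le_minus_one) auto
    also have "\<dots> \<le> 1" using n by (simp add: field_simps)
    finally have "ln (real n + 1) - ln (real n) \<le> 1" .
    moreover have "ln (real n) \<le> ln (real n + 1)" using n by simp
    ultimately show ?thesis
      using r stirling_gap_bounds[OF n(1)] by argo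
  qed
  then show "0 \<le> r" "r \<le> 1" by auto
qed

lemma kt_prob_pos: "kt_prob a b > 0"
  by (simp add: kt_prob_def pochhammer_half_pos)

lemma max_lik_pos: "max_lik a b > 0"
  by (cases "a = 0"; cases "b = 0") (auto simp: max_lik_def)

lemma max_lik_swap: "max_lik a b = max_lik b a"
  by (simp add: max_lik_def add.commute)

lemma ln_max_lik:
  "ln (max_lik a b) = real a * ln (real a) + real b * ln (real b) - real (a + b) * ln (real (a + b))"
  by (cases "a = 0"; cases "b = 0") (auto simp: max_lik_def ln_mult ln_realpow ln_div algebra_simps)

text \<open>The square root comes from the factorial alone. The linear terms -a, -b and a + b
  cancel, and the errors of the three factors add up to a number in [-3/2, 1].\<close>

lemma ln_kt_prob_bound: "\<bar>ln (kt_prob a b) - (ln (max_lik a b) - ln (real (a + b) + 1) / 2)\<bar> \<le> 2"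
proof -
  have "ln (kt_prob a b) = ln (pochhammer (1/2) a) + ln (pochhammer (1/2) b) - ln (fact (a + b))"
    using pochhammer_half_pos[of a] pochhammer_half_pos[of b] by (simp add: kt_prob_def ln_mult ln_div)
  then show ?thesis
    using ln_pochhammer_half_bounds[of a] ln_pochhammer_half_bounds[of b] ln_fact_bounds[of "a + b"]
      ln_max_lik[of a b]
    by (simp add: abs_le_iff algebra_simps)
qed

lemma kt_prob_max_lik_bounds:
  shows "kt_prob a b \<le> exp 2 * max_lik a b / sqrt (real (a + b) + 1)"
    and "exp (- 2) * max_lik a b / sqrt (real (a + b) + 1) \<le> kt_prob a b"
proof -
  have ln_rhs: "ln (exp c * max_lik a b / sqrt (real (a + b) + 1)) = c + ln (max_lik a b) - ln (real (a + b) + 1) / 2" for c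
    using max_lik_pos[of a b] by (simp add: ln_mult ln_div ln_sqrt)
  have pos: "exp c * max_lik a b / sqrt (real (a + b) + 1) > 0" for c
    using max_lik_pos[of a b] by (intro divide_pos_pos mult_pos_pos) auto
  have "ln (kt_prob a b) \<le> ln (exp 2 * max_lik a b / sqrt (real (a + b) + 1))"
    using ln_kt_prob_bound[of a b] unfolding ln_rhs by linarith
  then show "kt_prob a b \<le> exp 2 * max_lik a b / sqrt (real (a + b) + 1)"
    using kt_prob_pos pos by simp
  have "ln (exp (-2) * max_lik a b / sqrt (real (a + b) + 1)) \<le> ln (kt_prob a b)"
    using ln_kt_prob_bound[of a b] unfolding ln_rhs by linarith
  then show "exp (-2) * max_lik a b / sqrt (real (a + b) + 1) \<le> kt_prob a b"
    using kt_prob_pos pos by simp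
qed

text \<open>\<open>kt_prob a b\<close> is the integral of \<theta>^a (1 - \<theta>)^b against the
  Beta(1/2, 1/2) law, where the identity is 1 = \<theta> + (1 - \<theta>). The proof checks instead
  that the predictive probabilities (a + 1/2)/(a + b + 1) and (b + 1/2)/(a + b + 1) sum to
  1.\<close>

lemma kt_prob_split: "kt_prob (Suc a) b + kt_prob a (Suc b) = kt_prob a b"
proof -
  define c :: real where "c = pochhammer (1/2) a * pochhammer (1/2) b / fact (a + b)"
  have "kt_prob (Suc a) b = c * ((1/2 + real a) / (real a + real b + 1))"
    and "kt_prob a (Suc b) = c * ((1/2 + real b) / (real a + real b + 1))"
    by (simp_all add: kt_prob_def c_def pochhammer_Suc add_ac mult_ac)
  then have "kt_prob (Suc a) b + kt_prob a (Suc b)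
      = c * (((1/2 + real a) + (1/2 + real b)) / (real a + real b + 1))"
    by (simp only: add_divide_distrib distrib_left)
  then show ?thesis by (simp add: c_def kt_prob_def add.commute add.left_commute)
qed

lemma kt_prob_swap: "kt_prob a b = kt_prob b a"
  by (simp add: kt_prob_def add.commute mult.commute)

lemma Gamma_quotient_eq_kt_prob:
  "Gamma (real a + 1/2) * Gamma (real b + 1/2) / (Gamma (1/2) ^ 2 * Gamma (real a + real b + 1)) = kt_prob a b"
proof -
  have "Gamma (real a + 1/2) = pochhammer (1/2) a * Gamma (1/2)" for a
  proof -
    have "(1/2 :: real) \<notin> \<int>\<^sub>\<le>\<^sub>0"
      by (rule notI) (auto elim!: nonpos_Ints_cases)
    moreover have "Gamma (1/2 :: real) \<noteq> 0" by (simp add: Gamma_one_half_real)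
    ultimately show ?thesis
      using pochhammer_Gamma[of "1/2 :: real" a] by (simp add: add.commute)
  qed
  moreover have "Gamma (real a + real b + 1) = fact (a + b)"
    using Gamma_fact[of "a + b", where 'a = real] by (simp add: add.commute add.left_commute)
  moreover have "Gamma (1/2 :: real) \<noteq> 0" by (simp add: Gamma_one_half_real)
  ultimately show ?thesis
    by (simp add: kt_prob_def power2_eq_square field_simps)
qed

section \<open>Symbol and transition counts\<close>

lemma symbol_count_0 [simp]: "symbol_count j 0 x = 0"
  by (simp add: symbol_count_def)

lemma symbol_count_Suc:
  "symbol_count j (Suc t) x = symbol_count j t x + of_bool (x (Suc t) = j)"
proof -
  have "{s \<in> {1..Suc t}. x s = j} = {s \<in> {1..t}. x s = j} \<union> (if x (Suc t) = j then {Suc t} else {})"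
    by (auto simp: le_Suc_eq)
  then show ?thesis by (simp add: symbol_count_def)
qed

lemma trans_count_1: "trans_count j i (Suc 0) x = 0" "trans_count j i 0 x = 0"
  by (simp_all add: trans_count_def)

lemma trans_count_Suc:
  assumes "t \<ge> 1"
  shows "trans_count j i (Suc t) x = trans_count j i t x + of_bool (x t = i \<and> x (Suc t) = j)"
proof -
  have "{s \<in> {2..Suc t}. x (s - 1) = i \<and> x s = j}
      = {s \<in> {2..t}. x (s - 1) = i \<and> x s = j} \<union> (if x t = i \<and> x (Suc t) = j then {Suc t} else {})"
    using assms by (auto simp: le_Suc_eq)
  then show ?thesis by (simp add: trans_count_def)
qed

lemma symbol_count_cong:
  assumes "\<And>s. s \<in> {1..t} \<Longrightarrow> x s = y s"
  shows "symbol_count j t x = symbol_count j t y"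
  unfolding symbol_count_def using assms by (intro arg_cong[where f = card]) auto

lemma trans_count_cong:
  assumes "\<And>s. s \<in> {1..t} \<Longrightarrow> x s = y s"
  shows "trans_count j i t x = trans_count j i t y"
proof -
  have "(x (s - 1) = y (s - 1)) \<and> (x s = y s)" if "s \<in> {2..t}" for s
  proof -
    have "s \<in> {1..t}" "s - 1 \<in> {1..t}" using that by auto
    then show ?thesis by (simp only: assms)
  qed
  then show ?thesis
    unfolding trans_count_def by (intro arg_cong[where f = card]) auto
qed

lemma symbol_count_add: "symbol_count True t x + symbol_count False t x = t"
  by (induction t) (auto simp: symbol_count_Suc)

text \<open>Each occurrence of \<open>i\<close> starts a transition, except one at the final
  position; in the column version each occurrence ends one, except at position 1.\<close>

lemma trans_count_row_sum:
  assumes "t \<ge> 1"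
  shows "trans_count True i t x + trans_count False i t x + of_bool (x t = i) = symbol_count i t x"
  using assms
  by (induction t rule: nat_induct_at_least) (auto simp: trans_count_1 trans_count_Suc symbol_count_Suc)

lemma trans_count_column_sum:
  assumes "t \<ge> 1"
  shows "trans_count j True t x + trans_count j False t x + of_bool (x 1 = j) = symbol_count j t x"
  using assms
  by (induction t rule: nat_induct_at_least) (auto simp: trans_count_1 trans_count_Suc symbol_count_Suc)

text \<open>The first symbol is uniform, hence the factor 1/2, and the two rows of the transition
  matrix are mixed independently.\<close>

definition markov_mix :: "nat \<Rightarrow> (nat \<Rightarrow> bool) \<Rightarrow> real" where
  "markov_mix t x = (if t = 0 then 1 else
     kt_prob (trans_count False False t x) (trans_count True False t x)
     * kt_prob (trans_count False True t x) (trans_count True True t x) / 2)"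

definition bernoulli_lik :: "nat \<Rightarrow> (nat \<Rightarrow> bool) \<Rightarrow> real" where
  "bernoulli_lik t x = max_lik (symbol_count True t x) (symbol_count False t x)"

lemma markov_mix_pos: "markov_mix t x > 0"
  by (simp add: markov_mix_def kt_prob_pos)

lemma bernoulli_lik_pos: "bernoulli_lik t x > 0"
  by (simp add: bernoulli_lik_def max_lik_pos)

lemma R_eq: "R t x = markov_mix t x / bernoulli_lik t x"
proof (cases "t = 0")
  case True
  then show ?thesis by (simp add: R_def markov_mix_def bernoulli_lik_def max_lik_def)
next
  case False
  let ?g = "\<lambda>j i. Gamma (real (trans_count j i t x) + 1/2)"
  let ?s = "\<lambda>i. Gamma (real (trans_count False i t x) + real (trans_count True i t x) + 1)"
  let ?N = "?g False False * ?g False True * ?g True False * ?g True True / (2 * Gamma (1/2) ^ 4 * ?s False * ?s True)"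
  have "?N = (?g False False * ?g True False / (Gamma (1/2) ^ 2 * ?s False))
       * (?g False True * ?g True True / (Gamma (1/2) ^ 2 * ?s True)) / 2"
    by (simp add: power2_eq_square power4_eq_xxxx mult_ac)
  also have "\<dots> = markov_mix t x"
    unfolding Gamma_quotient_eq_kt_prob using False by (simp add: markov_mix_def)
  finally have N: "?N = markov_mix t x" .
  have "R t x = ?N / bernoulli_lik t x"
    using False symbol_count_add[of t x] by (simp add: R_def Let_def bernoulli_lik_def max_lik_def)
  then show ?thesis by (simp only: N)
qed

lemma R_pos: "R t x > 0"
  by (simp add: R_eq markov_mix_pos bernoulli_lik_pos)

section \<open>The growth rate\<close>

definition xlnx :: "real \<Rightarrow> real" where "xlnx u = u * ln u"

text \<open>The case that matters is \<open>a = 0\<close>, where \<open>ln\<close> is not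
  continuous: the right-hand limit of u ln u suffices because \<open>f\<close> stays nonnegative.
  This lets degenerate frequencies pass through the limits below without case distinctions.\<close>

lemma tendsto_xlnx:
  assumes "f \<longlonglongrightarrow> a" "\<And>t :: nat. f t \<ge> 0"
  shows "(\<lambda>t. xlnx (f t)) \<longlonglongrightarrow> xlnx a"
proof (cases "a = 0")
  case False
  then show ?thesis unfolding xlnx_def using assms(1) by (intro tendsto_intros)
next
  case True
  have "((\<lambda>u::real. u * ln u) \<longlongrightarrow> 0) (at_right 0)" by real_asymp
  then have "((\<lambda>u. xlnx u) \<longlongrightarrow> xlnx 0) (at 0 within {0..})"
    by (simp add: xlnx_def at_within_Ici_at_right)
  moreover have "filterlim f (nhds 0) sequentially" "\<forall>\<^sub>F t in sequentially. f t \<in> {0..}"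
    using assms True by auto
  ultimately show ?thesis
    using True continuous_within_tendsto_compose[of 0 "{0..}" xlnx f sequentially]
    by (auto simp: continuous_within)
qed

text \<open>The logarithm of the maximum likelihood is homogeneous of degree one in the counts:
  after division by \<open>t\<close> the contributions of \<open>ln (real t)\<close> cancel, and a
  continuous function of the frequencies remains.\<close>

lemma ln_max_lik_rate:
  fixes a b :: "nat \<Rightarrow> nat"
  assumes a: "(\<lambda>t. real (a t) / real t) \<longlonglongrightarrow> A" and b: "(\<lambda>t. real (b t) / real t) \<longlonglongrightarrow> B"
  shows "(\<lambda>t. ln (max_lik (a t) (b t)) / real t) \<longlonglongrightarrow> xlnx A + xlnx B - xlnx (A + B)"
proof -
  have "(\<lambda>t. real (a t + b t) / real t) \<longlonglongrightarrow> A + B"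
    using tendsto_add[OF a b] by (simp add: add_divide_distrib)
  then have "(\<lambda>t. xlnx (real (a t) / real t) + xlnx (real (b t) / real t) - xlnx (real (a t + b t) / real t))
      \<longlonglongrightarrow> xlnx A + xlnx B - xlnx (A + B)"
    by (intro tendsto_intros tendsto_xlnx a b) auto
  moreover have "\<forall>\<^sub>F t in sequentially.
      xlnx (real (a t) / real t) + xlnx (real (b t) / real t) - xlnx (real (a t + b t) / real t)
      = ln (max_lik (a t) (b t)) / real t"
  proof (rule eventually_mono[OF eventually_gt_at_top[of 0]])
    fix t :: nat assume t: "0 < t"
    have scale: "xlnx (real n / real t) = (real n * ln (real n) - real n * ln (real t)) / real t" for n
      using t by (cases "n = 0") (auto simp: xlnx_def ln_div field_simps)
    show "xlnx (real (a t) / real t) + xlnx (real (b t) / real t) - xlnx (real (a t + b t) / real t)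
        = ln (max_lik (a t) (b t)) / real t"
      unfolding scale ln_max_lik by (simp add: add_divide_distrib[symmetric] diff_divide_distrib[symmetric] algebra_simps)
  qed
  ultimately show ?thesis by (rule Lim_transform_eventually)
qed

lemma ln_kt_prob_rate:
  fixes a b :: "nat \<Rightarrow> nat"
  assumes a: "(\<lambda>t. real (a t) / real t) \<longlonglongrightarrow> A" and b: "(\<lambda>t. real (b t) / real t) \<longlonglongrightarrow> B"
    and le: "\<And>t. a t + b t \<le> t"
  shows "(\<lambda>t. ln (kt_prob (a t) (b t)) / real t) \<longlonglongrightarrow> xlnx A + xlnx B - xlnx (A + B)"
proof -
  have "(\<lambda>t. ln (kt_prob (a t) (b t)) / real t - ln (max_lik (a t) (b t)) / real t) \<longlonglongrightarrow> 0"
  proof (rule Lim_null_comparison)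
    show "\<forall>\<^sub>F t in sequentially. norm (ln (kt_prob (a t) (b t)) / real t - ln (max_lik (a t) (b t)) / real t)
        \<le> (2 + ln (real t + 1)) / real t"
    proof (rule always_eventually, rule allI)
      fix t
      have "\<bar>ln (kt_prob (a t) (b t)) - ln (max_lik (a t) (b t))\<bar> \<le> 2 + ln (real (a t + b t) + 1) / 2"
      proof -
        have "0 \<le> ln (real (a t + b t) + 1)" by simp
        then show ?thesis
          using ln_kt_prob_bound[of "a t" "b t"] unfolding abs_le_iff by argo
      qed
      also have "\<dots> \<le> 2 + ln (real t + 1)"
      proof -
        have "ln (real (a t + b t) + 1) \<le> ln (real t + 1)" "0 \<le> ln (real t + 1)"
          using le[of t] by auto
        then show ?thesis by linarith
      qed
      finally show "norm (ln (kt_prob (a t) (b t)) / real t - ln (max_lik (a t) (b t)) / real t)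
          \<le> (2 + ln (real t + 1)) / real t"
        unfolding real_norm_def diff_divide_distrib[symmetric] abs_divide
        by (simp add: divide_right_mono)
    qed
    show "(\<lambda>t. (2 + ln (real t + 1)) / real t) \<longlonglongrightarrow> 0" by real_asymp
  qed
  from tendsto_add[OF this ln_max_lik_rate[OF a b]] show ?thesis by simp
qed

text \<open>Twice the marginal entropy minus the joint entropy, for a pair of symbols with joint
  masses \<alpha> at 11, \<beta> at 00 and \<gamma> at each of 01 and 10. Written without quotients,
  it needs no convention for 0/0.\<close>

definition mutual_info :: "real \<Rightarrow> real \<Rightarrow> real \<Rightarrow> real \<Rightarrow> real" where
  "mutual_info \<alpha> \<beta> \<gamma> p = xlnx \<alpha> + xlnx \<beta> + 2 * xlnx \<gamma> - 2 * xlnx p - 2 * xlnx (1 - p)"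

text \<open>At p = 0 and p = 1 the relations force a point mass, and all the expressions vanish. In
  between, \<open>ratio\<close> is ordinary division and every logarithm of a quotient
  splits.\<close>

lemma rstar_eq_mutual_info:
  assumes "\<alpha> \<ge> 0" "\<beta> \<ge> 0" "\<gamma> \<ge> 0" "\<alpha> + \<gamma> = p" "\<beta> + \<gamma> = 1 - p"
  shows "rstar \<alpha> \<beta> \<gamma> p = mutual_info \<alpha> \<beta> \<gamma> p"
    and "\<gamma> * ln (ratio \<gamma> (1 - p)) + \<beta> * ln (ratio \<beta> (1 - p)) + \<alpha> * ln (ratio \<alpha> p)
          + \<gamma> * ln (ratio \<gamma> p) - p * ln p - (1 - p) * ln (1 - p) = mutual_info \<alpha> \<beta> \<gamma> p"
    and "bernoulli_entropy p - p * bernoulli_entropy (ratio \<alpha> p)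
          - (1 - p) * bernoulli_entropy (ratio \<gamma> (1 - p)) = mutual_info \<alpha> \<beta> \<gamma> p"
proof -
  consider "p = 0" | "p = 1" | "0 < p" "p < 1"
    using assms by linarith
  then have "rstar \<alpha> \<beta> \<gamma> p = mutual_info \<alpha> \<beta> \<gamma> p
    \<and> \<gamma> * ln (ratio \<gamma> (1 - p)) + \<beta> * ln (ratio \<beta> (1 - p)) + \<alpha> * ln (ratio \<alpha> p)
          + \<gamma> * ln (ratio \<gamma> p) - p * ln p - (1 - p) * ln (1 - p) = mutual_info \<alpha> \<beta> \<gamma> p
    \<and> bernoulli_entropy p - p * bernoulli_entropy (ratio \<alpha> p)
          - (1 - p) * bernoulli_entropy (ratio \<gamma> (1 - p)) = mutual_info \<alpha> \<beta> \<gamma> p"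
  proof cases
    case 1
    then have "\<alpha> = 0" "\<gamma> = 0" "\<beta> = 1" using assms by auto
    then show ?thesis
      using 1 by (simp add: rstar_def ratio_def mutual_info_def xlnx_def bernoulli_entropy_def)
  next
    case 2
    then have "\<alpha> = 1" "\<gamma> = 0" "\<beta> = 0" using assms by auto
    then show ?thesis
      using 2 by (simp add: rstar_def ratio_def mutual_info_def xlnx_def bernoulli_entropy_def)
  next
    case 3
    \<comment> \<open>Both sides vanish at a = 0, so transitions of frequency 0 need no separate
      treatment; likewise \<open>ln_inv\<close> at z = 0, where 1/0 and \<open>ln 0\<close> are both
      0.\<close>
    have log_ratio: "a * ln (a / q) = xlnx a - a * ln q" if "a \<ge> 0" "q > 0" for a q :: real
      using that by (cases "a = 0") (auto simp: xlnx_def ln_div algebra_simps)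
    have ln_inv: "ln (1 / z) = - ln z" if "z \<ge> 0" for z :: real
      using that by (cases "z = 0") (auto simp: ln_div)
    have ratio: "ratio a p = a / p" "ratio a (1 - p) = a / (1 - p)" for a
      using 3 by (auto simp: ratio_def)
    have second: "\<gamma> * ln (ratio \<gamma> (1 - p)) + \<beta> * ln (ratio \<beta> (1 - p)) + \<alpha> * ln (ratio \<alpha> p)
          + \<gamma> * ln (ratio \<gamma> p) - p * ln p - (1 - p) * ln (1 - p) = mutual_info \<alpha> \<beta> \<gamma> p"
    proof -
      have "\<gamma> * ln (ratio \<gamma> (1 - p)) + \<beta> * ln (ratio \<beta> (1 - p)) + \<alpha> * ln (ratio \<alpha> p)
          + \<gamma> * ln (ratio \<gamma> p) - p * ln p - (1 - p) * ln (1 - p)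
        = xlnx \<alpha> + xlnx \<beta> + 2 * xlnx \<gamma> - (\<alpha> + \<gamma>) * ln p - (\<beta> + \<gamma>) * ln (1 - p) - xlnx p - xlnx (1 - p)"
        using 3 assms(1-3) unfolding ratio by (simp add: log_ratio) (simp add: xlnx_def algebra_simps)
      then show ?thesis
        unfolding assms(4,5) by (simp add: mutual_info_def xlnx_def)
    qed
    have first: "rstar \<alpha> \<beta> \<gamma> p = \<gamma> * ln (ratio \<gamma> (1 - p)) + \<beta> * ln (ratio \<beta> (1 - p)) + \<alpha> * ln (ratio \<alpha> p)
          + \<gamma> * ln (ratio \<gamma> p) - p * ln p - (1 - p) * ln (1 - p)"
    proof -
      have "rstar \<alpha> \<beta> \<gamma> p = p * (- ln p + \<gamma> / p * ln (\<gamma> / (1 - p)) + \<alpha> / p * ln (\<alpha> / p))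
          + (1 - p) * (- ln (1 - p) + \<beta> / (1 - p) * ln (\<beta> / (1 - p)) + \<gamma> / (1 - p) * ln (\<gamma> / p))"
      proof -
        have "ln (1 / p) = - ln p" "ln (1 / (1 - p)) = - ln (1 - p)"
          "ln (1 / (\<gamma> / (1 - p))) = - ln (\<gamma> / (1 - p))" "ln (1 / (\<alpha> / p)) = - ln (\<alpha> / p)"
          "ln (1 / (\<beta> / (1 - p))) = - ln (\<beta> / (1 - p))" "ln (1 / (\<gamma> / p)) = - ln (\<gamma> / p)"
          using 3 assms by (intro ln_inv; simp)+
        moreover have "p \<noteq> 0" "p \<noteq> 1" using 3 by auto
        ultimately show ?thesis
          unfolding rstar_def Let_def ratio by (simp only: if_False mult_minus_right diff_minus_eq_add)
      qed
      moreover have "q * (- A + a / q * X + b / q * Y) = - (q * A) + a * X + b * Y"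
        if "q > 0" for q A a X b Y :: real
        using that by (simp add: field_simps)
      ultimately show ?thesis
        unfolding ratio using 3 by simp
    qed
    have entropy: "q * bernoulli_entropy (a / q) = - xlnx a - xlnx b + q * ln q"
      if "a \<ge> 0" "b \<ge> 0" "a + b = q" "q > 0" for a b q :: real
    proof -
      have "1 - a / q = b / q" using that by (simp add: field_simps)
      then have "q * bernoulli_entropy (a / q) = - (a * ln (a / q)) - b * ln (b / q)"
        using that by (simp add: bernoulli_entropy_def right_diff_distrib)
      also have "\<dots> = - xlnx a - xlnx b + (a + b) * ln q"
        unfolding log_ratio[OF that(1,4)] log_ratio[OF that(2,4)] by (simp add: algebra_simps)
      finally show ?thesis using that by simp
    qed
    have "bernoulli_entropy p - p * bernoulli_entropy (ratio \<alpha> p)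
          - (1 - p) * bernoulli_entropy (ratio \<gamma> (1 - p)) = mutual_info \<alpha> \<beta> \<gamma> p"
      using entropy[of \<alpha> \<gamma> p] entropy[of \<gamma> \<beta> "1 - p"] assms 3 unfolding ratio
      by (simp add: add.commute mutual_info_def) (simp add: bernoulli_entropy_def xlnx_def algebra_simps)
    with first second show ?thesis by simp
  qed
  then show "rstar \<alpha> \<beta> \<gamma> p = mutual_info \<alpha> \<beta> \<gamma> p"
    and "\<gamma> * ln (ratio \<gamma> (1 - p)) + \<beta> * ln (ratio \<beta> (1 - p)) + \<alpha> * ln (ratio \<alpha> p)
          + \<gamma> * ln (ratio \<gamma> p) - p * ln p - (1 - p) * ln (1 - p) = mutual_info \<alpha> \<beta> \<gamma> p"
    and "bernoulli_entropy p - p * bernoulli_entropy (ratio \<alpha> p)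
          - (1 - p) * bernoulli_entropy (ratio \<gamma> (1 - p)) = mutual_info \<alpha> \<beta> \<gamma> p"
    by auto
qed

text \<open>This is ln z \<le> z - 1 at z = m/n, with equality only at z = 1.\<close>

lemma relative_entropy_term:
  assumes "n \<ge> 0" "m > 0"
  shows "n - m \<le> xlnx n - n * ln m" and "xlnx n - n * ln m = n - m \<Longrightarrow> n = m"
proof -
  have "n - m \<le> xlnx n - n * ln m \<and> (xlnx n - n * ln m = n - m \<longrightarrow> n = m)"
  proof (cases "n = 0")
    case True
    then show ?thesis using assms by (simp add: xlnx_def)
  next
    case False
    then have n: "n > 0" using assms by simp
    have eq: "xlnx n - n * ln m - (n - m) = n * (m / n - 1 - ln (m / n))"
      using n assms by (simp add: xlnx_def ln_div field_simps)
    have "ln (m / n) \<le> m / n - 1" using n assms by (intro ln_le_minus_one) auto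
    then have "n * (m / n - 1 - ln (m / n)) \<ge> 0" using n by simp
    moreover have "n = m" if "n * (m / n - 1 - ln (m / n)) = 0"
    proof -
      have "ln (m / n) = m / n - 1" using that n by auto
      then have "m / n = 1" using n assms by (intro ln_eq_minus_one) auto
      then show ?thesis using n by simp
    qed
    ultimately show ?thesis using eq by fastforce
  qed
  then show "n - m \<le> xlnx n - n * ln m" and "xlnx n - n * ln m = n - m \<Longrightarrow> n = m" by auto
qed

text \<open>For 0 < p < 1 the mutual information is the relative entropy of the pair law with
  respect to the product of its marginals. The linear corrections in \<open>kl\<close> cancel in the
  sum because both laws have mass 1, so a sum of nonnegative terms is left.\<close>

lemma mutual_info_sign:
  assumes "\<alpha> \<ge> 0" "\<beta> \<ge> 0" "\<gamma> \<ge> 0" "\<alpha> + \<gamma> = p" "\<beta> + \<gamma> = 1 - p"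
  shows "mutual_info \<alpha> \<beta> \<gamma> p \<ge> 0" and "mutual_info \<alpha> \<beta> \<gamma> p = 0 \<longleftrightarrow> \<alpha> * (1 - p) = \<gamma> * p"
proof -
  consider "p = 0" | "p = 1" | "0 < p" "p < 1"
    using assms by linarith
  then have "mutual_info \<alpha> \<beta> \<gamma> p \<ge> 0 \<and> (mutual_info \<alpha> \<beta> \<gamma> p = 0 \<longleftrightarrow> \<alpha> * (1 - p) = \<gamma> * p)"
  proof cases
    case 1
    then have "\<alpha> = 0" "\<gamma> = 0" "\<beta> = 1" using assms by auto
    then show ?thesis using 1 by (simp add: mutual_info_def xlnx_def)
  next
    case 2
    then have "\<alpha> = 1" "\<gamma> = 0" "\<beta> = 0" using assms by auto
    then show ?thesis using 2 by (simp add: mutual_info_def xlnx_def)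
  next
    case 3
    define kl where "kl n m = xlnx n - n * ln m - (n - m)" for n m :: real
    have kl: "kl n m \<ge> 0" "kl n m = 0 \<Longrightarrow> n = m" if "n \<ge> 0" "m > 0" for n m
      using relative_entropy_term[OF that] by (auto simp: kl_def)
    have kl_self: "kl m m = 0" for m by (simp add: kl_def xlnx_def)
    have pos: "p * p > 0" "p * (1 - p) > 0" "(1 - p) * (1 - p) > 0" using 3 by auto
    have mi: "mutual_info \<alpha> \<beta> \<gamma> p = kl \<alpha> (p * p) + kl \<beta> ((1 - p) * (1 - p)) + 2 * kl \<gamma> (p * (1 - p))"
    proof -
      have "kl \<alpha> (p * p) + kl \<beta> ((1 - p) * (1 - p)) + 2 * kl \<gamma> (p * (1 - p))
        = xlnx \<alpha> + xlnx \<beta> + 2 * xlnx \<gamma> - 2 * (\<alpha> + \<gamma>) * ln p - 2 * (\<beta> + \<gamma>) * ln (1 - p)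
          - ((\<alpha> + \<gamma>) + (\<beta> + \<gamma>) - 1)"
      proof -
        have "ln (p * p) = 2 * ln p" "ln ((1 - p) * (1 - p)) = 2 * ln (1 - p)"
          and "ln (p * (1 - p)) = ln p + ln (1 - p)"
          using 3 by (simp_all add: ln_mult)
        then show ?thesis unfolding kl_def by (simp add: algebra_simps)
      qed
      then show ?thesis
        unfolding assms(4,5) by (simp add: mutual_info_def xlnx_def)
    qed
    have nonneg: "kl \<alpha> (p * p) \<ge> 0" "kl \<beta> ((1 - p) * (1 - p)) \<ge> 0" "kl \<gamma> (p * (1 - p)) \<ge> 0"
      using kl(1) assms pos by auto
    \<comment> \<open>With fixed marginals a single cell determines the joint law, so independence
      can be tested on the cell 11 alone.\<close>
    have indep: "\<alpha> * (1 - p) = \<gamma> * p \<longleftrightarrow> \<alpha> = p * p"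
    proof -
      have "\<gamma> = p - \<alpha>" using assms(4) by simp
      then show ?thesis by (auto simp: algebra_simps)
    qed
    have "\<alpha> = p * p" if "mutual_info \<alpha> \<beta> \<gamma> p = 0"
      using that mi nonneg kl(2)[OF assms(1) pos(1)] by linarith
    moreover have "mutual_info \<alpha> \<beta> \<gamma> p = 0" if "\<alpha> = p * p"
    proof -
      have "\<gamma> = p * (1 - p)" using that assms(4) by (simp add: algebra_simps)
      moreover have "\<beta> = (1 - p) * (1 - p)"
        using assms(5) \<open>\<gamma> = p * (1 - p)\<close> by (simp add: algebra_simps)
      ultimately show ?thesis using that mi by (simp add: kl_self)
    qed
    ultimately show ?thesis using indep mi nonneg by auto
  qed
  then show "mutual_info \<alpha> \<beta> \<gamma> p \<ge> 0" and "mutual_info \<alpha> \<beta> \<gamma> p = 0 \<longleftrightarrow> \<alpha> * (1 - p) = \<gamma> * p"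
    by auto
qed

lemma tendsto_divide_bounded_diff:
  fixes a b :: "nat \<Rightarrow> real"
  assumes "(\<lambda>t. a t / real t) \<longlonglongrightarrow> L" and "\<And>t. t \<ge> 1 \<Longrightarrow> \<bar>b t - a t\<bar> \<le> 1"
  shows "(\<lambda>t. b t / real t) \<longlonglongrightarrow> L"
proof -
  have "(\<lambda>t. b t / real t - a t / real t) \<longlonglongrightarrow> 0"
  proof (rule Lim_null_comparison[OF eventually_mono[OF eventually_ge_at_top[of 1]]])
    fix t :: nat assume "1 \<le> t"
    then show "norm (b t / real t - a t / real t) \<le> 1 / real t"
      using assms(2)[of t]
      unfolding real_norm_def diff_divide_distrib[symmetric] abs_divide
      by (simp add: divide_right_mono)
  qed (rule lim_1_over_n)
  from tendsto_add[OF this assms(1)] show ?thesis by simp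
qed

section \<open>Count frequencies and growth of \<open>R\<close> along one sequence\<close>

context
  fixes x :: "nat \<Rightarrow> bool" and \<alpha> \<beta> \<gamma> p :: real
  assumes lim11: "(\<lambda>t. real (trans_count True True t x) / real t) \<longlonglongrightarrow> \<alpha>"
    and lim00: "(\<lambda>t. real (trans_count False False t x) / real t) \<longlonglongrightarrow> \<beta>"
    and lim10: "(\<lambda>t. real (trans_count True False t x) / real t) \<longlonglongrightarrow> \<gamma>"
    and lim1: "(\<lambda>t. real (symbol_count True t x) / real t) \<longlonglongrightarrow> p"
begin

text \<open>The row sum and the column sum of the symbol 1 both give n_1, so the two counts differ
  by [x_1 = 1] - [x_t = 1].\<close>

lemma trans_limit_01: "(\<lambda>t. real (trans_count False True t x) / real t) \<longlonglongrightarrow> \<gamma>"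
proof (rule tendsto_divide_bounded_diff[OF lim10])
  fix t :: nat assume "t \<ge> 1"
  then show "\<bar>real (trans_count False True t x) - real (trans_count True False t x)\<bar> \<le> 1"
    using trans_count_row_sum[of t True x] trans_count_column_sum[of t True x]
    by (auto simp: of_bool_def split: if_splits)
qed

lemma trans_limit_1: "(\<lambda>t. real (trans_count True True t x + trans_count False True t x) / real t) \<longlonglongrightarrow> p"
proof (rule tendsto_divide_bounded_diff[OF lim1])
  fix t :: nat assume "t \<ge> 1"
  then show "\<bar>real (trans_count True True t x + trans_count False True t x) - real (symbol_count True t x)\<bar> \<le> 1"
    using trans_count_row_sum[of t True x] by (auto simp: of_bool_def split: if_splits)
qed

lemma symbol_limit_0: "(\<lambda>t. real (symbol_count False t x) / real t) \<longlonglongrightarrow> 1 - p"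
proof -
  have "(\<lambda>t. 1 - real (symbol_count True t x) / real t) \<longlonglongrightarrow> 1 - p"
    by (intro tendsto_intros lim1)
  moreover have "\<forall>\<^sub>F t in sequentially. 1 - real (symbol_count True t x) / real t = real (symbol_count False t x) / real t"
  proof (rule eventually_mono[OF eventually_gt_at_top[of 0]])
    fix t :: nat assume "0 < t"
    moreover have "real (symbol_count True t x) + real (symbol_count False t x) = real t"
      by (metis of_nat_add symbol_count_add)
    ultimately show "1 - real (symbol_count True t x) / real t = real (symbol_count False t x) / real t"
      by (simp add: field_simps)
  qed
  ultimately show ?thesis by (rule Lim_transform_eventually)
qed

lemma limit_relations:
  shows "\<alpha> \<ge> 0" "\<beta> \<ge> 0" "\<gamma> \<ge> 0" "\<alpha> + \<gamma> = p" "\<beta> + \<gamma> = 1 - p"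
proof -
  show "\<alpha> \<ge> 0" by (rule LIMSEQ_le_const[OF lim11]) auto
  show "\<beta> \<ge> 0" by (rule LIMSEQ_le_const[OF lim00]) auto
  show "\<gamma> \<ge> 0" by (rule LIMSEQ_le_const[OF lim10]) auto
  show "\<alpha> + \<gamma> = p"
    using tendsto_add[OF lim11 trans_limit_01] trans_limit_1 by (simp add: add_divide_distrib LIMSEQ_unique)
  have "(\<lambda>t. (real (trans_count False False t x) + real (trans_count True False t x)) / real t) \<longlonglongrightarrow> 1 - p"
  proof (rule tendsto_divide_bounded_diff[OF symbol_limit_0])
    fix t :: nat assume "t \<ge> 1"
    then show "\<bar>real (trans_count False False t x) + real (trans_count True False t x) - real (symbol_count False t x)\<bar> \<le> 1"
      using trans_count_row_sum[of t False x] by (auto simp: of_bool_def split: if_splits)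
  qed
  then show "\<beta> + \<gamma> = 1 - p"
    using tendsto_add[OF lim00 lim10] by (simp add: add_divide_distrib LIMSEQ_unique)
qed

text \<open>The row totals have limits p and 1 - p, so \<open>xlnx p\<close> and
  \<open>xlnx (1 - p)\<close> appear once from the Markov mixture and once from the Bernoulli
  likelihood; hence the coefficients 2 in \<open>mutual_info\<close>.\<close>

lemma ln_R_rate: "(\<lambda>t. ln (R t x) / real t) \<longlonglongrightarrow> mutual_info \<alpha> \<beta> \<gamma> p"
proof -
  let ?k = "\<lambda>i t. ln (kt_prob (trans_count False i t x) (trans_count True i t x)) / real t"
  have le: "trans_count False i t x + trans_count True i t x \<le> t" for i t
  proof (cases "t = 0")
    case False
    then show ?thesis
      using trans_count_row_sum[of t i x] symbol_count_add[of t x] by (cases i) auto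
  qed (simp add: trans_count_1)
  have "(\<lambda>t. ?k False t + ?k True t - ln 2 / real t - ln (bernoulli_lik t x) / real t)
      \<longlonglongrightarrow> (xlnx \<beta> + xlnx \<gamma> - xlnx (\<beta> + \<gamma>)) + (xlnx \<gamma> + xlnx \<alpha> - xlnx (\<gamma> + \<alpha>)) - 0
         - (xlnx p + xlnx (1 - p) - xlnx (p + (1 - p)))"
    unfolding bernoulli_lik_def
    by (intro tendsto_diff tendsto_add ln_kt_prob_rate ln_max_lik_rate lim11 lim00 lim10 trans_limit_01 lim1 symbol_limit_0 le
        real_tendsto_divide_at_top[OF tendsto_const filterlim_real_sequentially])
  also have "(xlnx \<beta> + xlnx \<gamma> - xlnx (\<beta> + \<gamma>)) + (xlnx \<gamma> + xlnx \<alpha> - xlnx (\<gamma> + \<alpha>)) - 0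
         - (xlnx p + xlnx (1 - p) - xlnx (p + (1 - p))) = mutual_info \<alpha> \<beta> \<gamma> p"
    using limit_relations(4,5) by (simp add: mutual_info_def add.commute) (simp add: xlnx_def)
  finally have lim: "(\<lambda>t. ?k False t + ?k True t - ln 2 / real t - ln (bernoulli_lik t x) / real t)
      \<longlonglongrightarrow> mutual_info \<alpha> \<beta> \<gamma> p" .
  show ?thesis
  proof (rule Lim_transform_eventually[OF lim eventually_mono[OF eventually_gt_at_top[of 0]]])
    fix t :: nat assume "0 < t"
    then show "?k False t + ?k True t - ln 2 / real t - ln (bernoulli_lik t x) / real t = ln (R t x) / real t"
      using kt_prob_pos bernoulli_lik_pos
      by (simp add: R_eq markov_mix_def ln_div ln_mult less_imp_neq[THEN not_sym] add_divide_distrib diff_divide_distrib)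
  qed
qed

lemma R_exponential_growth:
  assumes "mutual_info \<alpha> \<beta> \<gamma> p > 0"
  shows "filterlim (\<lambda>t. R t x) at_top sequentially"
    and "\<exists>c>0. \<forall>\<^sub>F t in sequentially. exp (c * real t) \<le> R t x"
proof -
  define c where "c = mutual_info \<alpha> \<beta> \<gamma> p / 2"
  have c: "c > 0" "c < mutual_info \<alpha> \<beta> \<gamma> p" using assms by (auto simp: c_def)
  have "\<forall>\<^sub>F t in sequentially. c < ln (R t x) / real t"
    using order_tendstoD(1)[OF ln_R_rate c(2)] .
  then have growth: "\<forall>\<^sub>F t in sequentially. exp (c * real t) \<le> R t x"
    using eventually_gt_at_top[of 0]
  proof eventually_elim
    case (elim t)
    then have "c * real t \<le> ln (R t x)" by (simp add: field_simps)
    then show ?case using R_pos[of t x] by (simp add: ln_ge_iff)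
  qed
  then show "\<exists>c>0. \<forall>\<^sub>F t in sequentially. exp (c * real t) \<le> R t x" using c(1) by blast
  have "filterlim (\<lambda>t. exp (c * real t)) at_top sequentially"
    using c(1) by real_asymp
  then show "filterlim (\<lambda>t. R t x) at_top sequentially"
    using growth by (rule filterlim_at_top_mono)
qed

end

section \<open>Consistent weights on binary words\<close>

text \<open>Extensionality makes each word occur exactly once in a sum. Words and infinite sequences
  thereby share one type, and a function of words of length t is a function of sequences that is
  \<open>determined t\<close>.\<close>

definition words :: "nat \<Rightarrow> (nat \<Rightarrow> bool) set" where
  "words t = ({1..t} \<rightarrow>\<^sub>E UNIV)"

lemma finite_words [simp]: "finite (words t)"
  by (simp add: words_def finite_PiE)

definition determined :: "nat \<Rightarrow> ((nat \<Rightarrow> bool) \<Rightarrow> 'a) \<Rightarrow> bool" where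
  "determined t h \<longleftrightarrow> (\<forall>x y. (\<forall>s\<in>{1..t}. x s = y s) \<longrightarrow> h x = h y)"

lemma determinedI:
  assumes "\<And>x y. (\<And>s. s \<in> {1..t} \<Longrightarrow> x s = y s) \<Longrightarrow> h x = h y"
  shows "determined t h"
  unfolding determined_def by (intro allI impI assms) blast

lemma determinedD:
  assumes "determined t h" "\<And>s. s \<in> {1..t} \<Longrightarrow> x s = y s"
  shows "h x = h y"
  using assms(1)[unfolded determined_def, THEN spec, THEN spec, THEN mp] assms(2) by blast

lemma determined_mono:
  assumes "determined t h" "t \<le> n"
  shows "determined n h"
proof (rule determinedI)
  fix x y :: "nat \<Rightarrow> bool"
  assume "\<And>s. s \<in> {1..n} \<Longrightarrow> x s = y s"
  then show "h x = h y" using assms(2) by (intro determinedD[OF assms(1)]) simp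
qed

lemma determined_comp:
  assumes "determined t f"
  shows "determined t (\<lambda>x. H (f x))"
proof (rule determinedI)
  fix x y :: "nat \<Rightarrow> bool"
  assume "\<And>s. s \<in> {1..t} \<Longrightarrow> x s = y s"
  then have "f x = f y" by (rule determinedD[OF assms])
  then show "H (f x) = H (f y)" by (rule arg_cong)
qed

lemma determined_comp2:
  assumes "determined t f" "determined t g"
  shows "determined t (\<lambda>x. H (f x) (g x))"
proof (rule determinedI)
  fix x y :: "nat \<Rightarrow> bool"
  assume "\<And>s. s \<in> {1..t} \<Longrightarrow> x s = y s"
  then have "f x = f y" and "g x = g y"
    using determinedD[OF assms(1), of x y] determinedD[OF assms(2), of x y] by auto
  then show "H (f x) (g x) = H (f y) (g y)" by (rule arg_cong2)
qed

lemma determined_symbol_count: "determined t (symbol_count j t)"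
  by (rule determinedI) (rule symbol_count_cong)

lemma determined_markov_mix: "determined t (markov_mix t)"
proof (rule determinedI)
  fix x y :: "nat \<Rightarrow> bool"
  assume "\<And>s. s \<in> {1..t} \<Longrightarrow> x s = y s"
  then have "trans_count j i t x = trans_count j i t y" for j i by (rule trans_count_cong)
  then show "markov_mix t x = markov_mix t y" by (simp add: markov_mix_def)
qed

lemma determined_bernoulli_lik: "determined t (bernoulli_lik t)"
  unfolding bernoulli_lik_def[abs_def]
  by (rule determined_comp2[where H = max_lik, OF determined_symbol_count determined_symbol_count])

lemma determined_R: "determined t (R t)"
  unfolding R_eq[abs_def]
  by (rule determined_comp2[where H = "(/)", OF determined_markov_mix determined_bernoulli_lik])

text \<open>The cylinder masses of a probability law on sequences, with Kolmogorov's consistency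
  condition as \<open>split\<close>. The two mixtures and every exchangeable law are instances, so
  they can be compared word by word.\<close>

locale consistent_weights =
  fixes v :: "nat \<Rightarrow> (nat \<Rightarrow> bool) \<Rightarrow> real"
  assumes nonneg: "v t x \<ge> 0"
    and determined: "determined t (v t)"
    and total: "v 0 x = 1"
    and split: "v t x = v (Suc t) (x(Suc t := True)) + v (Suc t) (x(Suc t := False))"
begin

definition expect :: "nat \<Rightarrow> ((nat \<Rightarrow> bool) \<Rightarrow> real) \<Rightarrow> real" where
  "expect t h = (\<Sum>x\<in>words t. v t x * h x)"

lemma expect_Suc:
  assumes "determined t h"
  shows "expect (Suc t) h = expect t h"
proof -
  have "words (Suc t) = (\<lambda>(b, x). x(Suc t := b)) ` (UNIV \<times> words t)"
  proof -
    have "{1..Suc t} = insert (Suc t) {1..t}" by auto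
    then show ?thesis by (simp only: words_def PiE_insert_eq)
  qed
  moreover have "inj_on (\<lambda>(b, x). x(Suc t := b)) (UNIV \<times> words t)"
    unfolding words_def using inj_combinator[of "Suc t" "{1..t}" "\<lambda>_. UNIV"] by simp
  ultimately have "expect (Suc t) h
      = (\<Sum>(b, x)\<in>UNIV \<times> words t. v (Suc t) (x(Suc t := b)) * h (x(Suc t := b)))"
    unfolding expect_def by (simp add: sum.reindex case_prod_unfold)
  also have "\<dots> = (\<Sum>x\<in>words t. \<Sum>b\<in>UNIV. v (Suc t) (x(Suc t := b)) * h (x(Suc t := b)))"
    by (simp add: sum.cartesian_product[symmetric] sum.swap[of _ UNIV])
  also have "\<dots> = (\<Sum>x\<in>words t. v t x * h x)"
  proof (rule sum.cong[OF refl])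
    fix x
    have "h (x(Suc t := b)) = h x" for b
      by (rule determinedD[OF assms]) simp
    then show "(\<Sum>b\<in>UNIV. v (Suc t) (x(Suc t := b)) * h (x(Suc t := b))) = v t x * h x"
      using split[of t x] by (simp add: UNIV_bool algebra_simps)
  qed
  finally show ?thesis by (simp add: expect_def)
qed

lemma expect_marginal:
  assumes "determined t h" "t \<le> n"
  shows "expect n h = expect t h"
  using assms(2)
proof (induction n rule: dec_induct)
  case (step n)
  then show ?case using expect_Suc[OF determined_mono[OF assms(1) step.hyps(1)]] by simp
qed simp

lemma expect_one: "expect t (\<lambda>_. 1) = 1"
proof -
  have "expect t (\<lambda>_. 1) = expect 0 (\<lambda>_. 1)"
    by (rule expect_marginal) (auto simp: determined_def)
  then show ?thesis by (simp add: expect_def words_def total)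
qed

lemma expect_mono:
  assumes "\<And>x. x \<in> words t \<Longrightarrow> h x \<le> g x"
  shows "expect t h \<le> expect t g"
  unfolding expect_def using assms nonneg by (intro sum_mono mult_left_mono) auto

lemma expect_const: "expect t (\<lambda>_. c) = c"
  using expect_one[of t] by (simp add: expect_def sum_distrib_right[symmetric])

lemma expect_add: "expect t (\<lambda>x. g x + h x) = expect t g + expect t h"
  by (simp add: expect_def algebra_simps sum.distrib)

lemma expect_diff: "expect t (\<lambda>x. g x - h x) = expect t g - expect t h"
  by (simp add: expect_def algebra_simps sum_subtractf)

lemma expect_scale: "expect t (\<lambda>x. c * h x) = c * expect t h"
  by (simp add: expect_def sum_distrib_left mult.left_commute)

lemma expect_sum: "expect t (\<lambda>x. \<Sum>i\<in>I. h i x) = (\<Sum>i\<in>I. expect t (h i))"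
  by (simp add: expect_def sum_distrib_left) (rule sum.swap)

lemma expect_cylinder:
  assumes "t \<le> n"
  shows "expect n (\<lambda>y. of_bool (\<forall>s\<in>{1..t}. y s = x s)) = v t x"
proof -
  let ?r = "restrict x {1..t}"
  have "expect n (\<lambda>y. of_bool (\<forall>s\<in>{1..t}. y s = x s)) = expect t (\<lambda>y. of_bool (\<forall>s\<in>{1..t}. y s = x s))"
    by (rule expect_marginal) (auto simp: determined_def assms)
  also have "\<dots> = (\<Sum>y\<in>words t. if y = ?r then v t ?r else 0)"
    unfolding expect_def
  proof (rule sum.cong[OF refl])
    fix y assume "y \<in> words t"
    then have "(\<forall>s\<in>{1..t}. y s = x s) \<longleftrightarrow> y = ?r"
      by (auto simp: words_def fun_eq_iff PiE_def extensional_def)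
    then show "v t y * of_bool (\<forall>s\<in>{1..t}. y s = x s) = (if y = ?r then v t ?r else 0)"
      by simp
  qed
  also have "\<dots> = v t ?r"
  proof -
    have "?r \<in> words t" by (simp add: words_def)
    then show ?thesis by simp
  qed
  also have "\<dots> = v t x"
    by (rule determinedD[OF determined]) simp
  finally show ?thesis .
qed

end

lemma trans_count_upd:
  "t \<ge> 1 \<Longrightarrow> trans_count j i (Suc t) (x(Suc t := b)) = trans_count j i t x + of_bool (x t = i \<and> b = j)"
  using trans_count_cong[of t "x(Suc t := b)" x j i] by (simp add: trans_count_Suc)

lemma symbol_count_upd:
  "symbol_count j (Suc t) (x(Suc t := b)) = symbol_count j t x + of_bool (b = j)"
  using symbol_count_cong[of t "x(Suc t := b)" x j] by (simp add: symbol_count_Suc)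

text \<open>Appending a symbol changes only the row of the last symbol, and there
  \<open>kt_prob_split\<close> applies. The facts 1 and 2 in the proof are this split in the first
  and in the second factor.\<close>

lemma markov_mix_consistent: "consistent_weights markov_mix"
proof
  show "markov_mix t x \<ge> 0" for t x by (simp add: less_imp_le markov_mix_pos)
  show "determined t (markov_mix t)" for t by (rule determined_markov_mix)
  show "markov_mix 0 x = 1" for x by (simp add: markov_mix_def)
  show "markov_mix t x = markov_mix (Suc t) (x(Suc t := True)) + markov_mix (Suc t) (x(Suc t := False))" for t x
  proof (cases "t = 0")
    case True
    then show ?thesis by (simp add: markov_mix_def trans_count_1 kt_prob_def)
  next
    case False
    have 1: "kt_prob a b * c / 2 = kt_prob a (Suc b) * c / 2 + kt_prob (Suc a) b * c / 2" for a b and c :: real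
      unfolding kt_prob_split[of a b, symmetric] by (simp only: distrib_right add_divide_distrib add.commute)
    have 2: "c * kt_prob a b / 2 = c * kt_prob a (Suc b) / 2 + c * kt_prob (Suc a) b / 2" for a b and c :: real
      using 1[of a b c] by (simp only: mult.commute[of c])
    have upd: "trans_count j i (Suc t) (x(Suc t := b)) = trans_count j i t x + of_bool (x t = i \<and> b = j)" for j i b
      using False by (intro trans_count_upd) simp
    show ?thesis
    proof (cases "x t")
      case True
      then show ?thesis
        unfolding markov_mix_def upd using False by (simp add: 2[symmetric] add.commute)
    next
      case x: False
      then show ?thesis
        unfolding markov_mix_def upd using False by (simp add: 1[symmetric] add.commute)
    qed
  qed
qed

text \<open>A reference law with one parameter: its total mass 1 is what bounds the Markov mass of
  the regular words later.\<close>

definition bernoulli_mix :: "nat \<Rightarrow> (nat \<Rightarrow> bool) \<Rightarrow> real" where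
  "bernoulli_mix t x = kt_prob (symbol_count True t x) (symbol_count False t x)"

lemma bernoulli_mix_consistent: "consistent_weights bernoulli_mix"
proof
  show "bernoulli_mix t x \<ge> 0" for t x by (simp add: bernoulli_mix_def less_imp_le kt_prob_pos)
  show "determined t (bernoulli_mix t)" for t
    unfolding bernoulli_mix_def[abs_def]
    by (rule determined_comp2[where H = kt_prob, OF determined_symbol_count determined_symbol_count])
  show "bernoulli_mix 0 x = 1" for x by (simp add: bernoulli_mix_def kt_prob_def)
  show "bernoulli_mix t x = bernoulli_mix (Suc t) (x(Suc t := True)) + bernoulli_mix (Suc t) (x(Suc t := False))" for t x
    by (simp add: bernoulli_mix_def symbol_count_upd kt_prob_split)
qed

interpretation markov_mix: consistent_weights markov_mix by (rule markov_mix_consistent)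
interpretation bernoulli_mix: consistent_weights bernoulli_mix by (rule bernoulli_mix_consistent)

section \<open>Exchangeable weights\<close>

locale exchangeable_weights = consistent_weights +
  assumes perm: "\<sigma> permutes {1..t} \<Longrightarrow> v t (x \<circ> \<sigma>) = v t x"
begin

lemma expect_perm:
  assumes "\<sigma> permutes {1..t}"
  shows "expect t (\<lambda>x. h (x \<circ> \<sigma>)) = expect t h"
proof -
  have closed: "x \<circ> \<tau> \<in> words t" if "\<tau> permutes {1..t}" "x \<in> words t" for x :: "nat \<Rightarrow> bool" and \<tau>
    using that permutes_not_in[OF that(1)] by (auto simp: words_def PiE_def extensional_def)
  have "bij_betw (\<lambda>x. x \<circ> \<sigma>) (words t) (words t)"
  proof (rule bij_betwI)
    show "(\<lambda>x. x \<circ> \<sigma>) \<in> words t \<rightarrow> words t" using closed[OF assms] by auto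
    show "(\<lambda>x. x \<circ> inv \<sigma>) \<in> words t \<rightarrow> words t" using closed[OF permutes_inv[OF assms]] by auto
  qed (auto simp: comp_assoc permutes_inv_o[OF assms])
  from sum.reindex_bij_betw[OF this, of "\<lambda>x. v t x * h x"] show ?thesis
    by (simp add: expect_def perm[OF assms])
qed

end

section \<open>Maximum likelihood bounds the probabilities of exchangeable words\<close>

lemma permutes_extend:
  assumes "inj_on f {1..t}" "f ` {1..t} \<subseteq> {1..N :: nat}" "t \<le> N"
  obtains \<sigma> where "\<sigma> permutes {1..N}" "\<And>s. s \<in> {1..t} \<Longrightarrow> \<sigma> s = f s"
proof -
  have card: "card ({1..N} - {1..t}) = card ({1..N} - f ` {1..t})"
    using assms by (simp add: card_Diff_subset card_image)
  have "\<exists>g. bij_betw g ({1..N} - {1..t}) ({1..N} - f ` {1..t})"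
    by (rule finite_same_card_bij[OF _ _ card]) simp_all
  then obtain g where g: "bij_betw g ({1..N} - {1..t}) ({1..N} - f ` {1..t})"
    by blast
  define \<sigma> where "\<sigma> s = (if s \<in> {1..t} then f s else if s \<in> {1..N} then g s else s)" for s
  have "bij_betw \<sigma> {1..t} (f ` {1..t})"
    using inj_on_imp_bij_betw[OF assms(1)] by (rule bij_betw_cong[THEN iffD1, rotated]) (simp add: \<sigma>_def)
  moreover have "bij_betw \<sigma> ({1..N} - {1..t}) ({1..N} - f ` {1..t})"
    using g by (rule bij_betw_cong[THEN iffD1, rotated]) (simp add: \<sigma>_def)
  ultimately have "bij_betw \<sigma> ({1..t} \<union> ({1..N} - {1..t})) (f ` {1..t} \<union> ({1..N} - f ` {1..t}))"
    by (rule bij_betw_combine) auto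
  moreover have "{1..t} \<union> ({1..N} - {1..t}) = {1..N}" "f ` {1..t} \<union> ({1..N} - f ` {1..t}) = {1..N}"
    using assms by auto
  ultimately have "bij_betw \<sigma> {1..N} {1..N}" by simp
  then have "\<sigma> permutes {1..N}"
    using assms(3) by (intro bij_imp_permutes) (auto simp: \<sigma>_def)
  then show ?thesis by (rule that) (simp add: \<sigma>_def)
qed

text \<open>The number of injections is the falling factorial N (N - 1) ... (N - t + 1), each of
  whose factors exceeds N - t. The proof counts them as distinct lists.\<close>

lemma card_injections_ge:
  assumes "t \<le> N"
  shows "(N - t) ^ t \<le> card {f \<in> {1..t} \<rightarrow>\<^sub>E {1..N}. inj_on f {1..t}}"
proof -
  let ?L = "{xs. length xs = t \<and> distinct xs \<and> set xs \<subseteq> {1..N}}"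
  let ?F = "\<lambda>xs. \<lambda>s\<in>{1..t}. xs ! (s - 1)"
  have "(N - t) ^ t = (\<Prod>i\<in>{N - t + 1..N}. N - t)"
    using assms by simp
  also have "\<dots> \<le> (\<Prod>i\<in>{N - t + 1..N}. i)"
    by (rule prod_mono) auto
  also have "\<dots> = card ?L"
    using card_lists_distinct_length_eq[of "{1..N}" t] assms by simp
  also have "\<dots> \<le> card {f \<in> {1..t} \<rightarrow>\<^sub>E {1..N}. inj_on f {1..t}}"
  proof (rule card_inj_on_le[where f = ?F])
    show "inj_on ?F ?L"
    proof (rule inj_onI)
      fix xs ys assume xs: "xs \<in> ?L" and ys: "ys \<in> ?L" and eq: "?F xs = ?F ys"
      show "xs = ys"
      proof (rule nth_equalityI)
        fix i assume "i < length xs"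
        then show "xs ! i = ys ! i" using fun_cong[OF eq, of "Suc i"] xs by simp
      qed (use xs ys in auto)
    qed
    show "?F ` ?L \<subseteq> {f \<in> {1..t} \<rightarrow>\<^sub>E {1..N}. inj_on f {1..t}}"
    proof (rule image_subsetI)
      fix xs assume xs: "xs \<in> ?L"
      have "inj_on (?F xs) {1..t}"
      proof (rule inj_onI)
        fix s s' assume "s \<in> {1..t}" "s' \<in> {1..t}" "?F xs s = ?F xs s'"
        then have "s - 1 = s' - 1" using xs nth_eq_iff_index_eq[of xs "s - 1" "s' - 1"] by auto
        then show "s = s'" using \<open>s \<in> {1..t}\<close> \<open>s' \<in> {1..t}\<close> by auto
      qed
      moreover have "xs ! (s - 1) \<in> {1..N}" if "s \<in> {1..t}" for s
      proof -
        have "xs ! (s - 1) \<in> set xs" using that xs by (intro nth_mem) auto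
        then show ?thesis using xs by auto
      qed
      ultimately show "?F xs \<in> {f \<in> {1..t} \<rightarrow>\<^sub>E {1..N}. inj_on f {1..t}}" by simp
    qed
    show "finite {f \<in> {1..t} \<rightarrow>\<^sub>E {1..N}. inj_on f {1..t}}"
      by (simp add: finite_PiE)
  qed
  finally show ?thesis .
qed

text \<open>As a function of m, the product m^n e^(-m) is largest at m = n; the proof is z \<le>
  e^(z - 1) at z = m/n.\<close>

lemma power_le_exp:
  fixes m :: real
  assumes "m \<ge> 0"
  shows "m ^ n \<le> real n ^ n * exp (m - real n)"
proof (cases "n = 0")
  case False
  have "m / real n \<le> exp (m / real n - 1)"
    using exp_ge_add_one_self[of "m / real n - 1"] by simp
  then have "(m / real n) ^ n \<le> exp (m / real n - 1) ^ n"
    using assms by (intro power_mono) auto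
  also have "\<dots> = exp (m - real n)"
    using False by (simp add: exp_of_nat_mult[symmetric] algebra_simps)
  finally show ?thesis using False by (simp add: field_simps)
qed (use assms in simp)

text \<open>After scaling u and w to the sum a + b, \<open>power_le_exp\<close> applies to both
  powers, and the two exponentials cancel because their exponents sum to 0.\<close>

lemma max_lik_maximal:
  fixes u w N :: real
  assumes "u \<ge> 0" "w \<ge> 0" "u + w = N"
  shows "u ^ a * w ^ b \<le> N ^ (a + b) * max_lik a b"
proof (cases "a + b = 0 \<or> N = 0")
  case True
  then show ?thesis
  proof
    assume N: "N = 0"
    then have "u = 0" "w = 0" using assms by auto
    then show ?thesis using N by (cases "a = 0"; cases "b = 0") (auto simp: max_lik_def power_0_left)
  qed (simp add: max_lik_def)
next
  case False
  define t where "t = real (a + b)"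
  have t: "t > 0" and N: "N > 0" using False assms by (auto simp: t_def)
  let ?u = "u * t / N" and ?w = "w * t / N"
  have "?u ^ a * ?w ^ b \<le> (real a ^ a * exp (?u - real a)) * (real b ^ b * exp (?w - real b))"
    using assms t N by (intro mult_mono power_le_exp) auto
  also have "\<dots> = real a ^ a * real b ^ b * exp ((?u + ?w) - t)"
    by (simp add: t_def exp_add[symmetric] algebra_simps)
  also have "?u + ?w = t" using assms N by (simp add: field_simps flip: distrib_left)
  finally have "?u ^ a * ?w ^ b \<le> real a ^ a * real b ^ b" by simp
  moreover have "?u ^ a * ?w ^ b = u ^ a * w ^ b * (t ^ (a + b) / N ^ (a + b))"
    by (simp add: power_mult_distrib power_divide power_add)
  ultimately have "u ^ a * w ^ b * (t ^ (a + b) / N ^ (a + b)) * (N ^ (a + b) / t ^ (a + b))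
      \<le> real a ^ a * real b ^ b * (N ^ (a + b) / t ^ (a + b))"
    using t N by (intro mult_right_mono) auto
  then have "u ^ a * w ^ b \<le> real a ^ a * real b ^ b * (N ^ (a + b) / t ^ (a + b))"
    using t N by (simp add: mult.assoc)
  then show ?thesis
    by (simp add: max_lik_def power_divide power_add t_def mult_ac)
qed

lemma prod_symbol_indicator:
  fixes f :: "bool \<Rightarrow> real"
  shows "(\<Prod>s\<in>{1..t}. f (x s)) = f True ^ symbol_count True t x * f False ^ symbol_count False t x"
  by (induction t) (auto simp: symbol_count_Suc)

lemma sum_symbol_indicator: "(\<Sum>s\<in>{1..t}. of_bool (x s = j) :: real) = real (symbol_count j t x)"
  by (induction t) (auto simp: symbol_count_Suc)

context exchangeable_weights
begin

text \<open>
  The probability of a word is the chance that sampling without replacement from a much longer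
  word produces it.  Sampling with replacement instead gives a likelihood of the form
  \<open>\<theta>\<^sup>a (1 - \<theta>)\<^sup>b\<close>, which the maximum likelihood dominates.
\<close>

lemma le_bernoulli_lik_sampling:
  assumes "t \<le> N"
  shows "real (N - t) ^ t * v t x \<le> real N ^ t * bernoulli_lik t x"
proof -
  let ?I = "{f \<in> {1..t} \<rightarrow>\<^sub>E {1..N}. inj_on f {1..t}}"
  define g where "g f y = (\<Prod>s\<in>{1..t}. of_bool (y (f s) = x s) :: real)" for f :: "nat \<Rightarrow> nat" and y :: "nat \<Rightarrow> bool"
  have g_nonneg: "g f y \<ge> 0" for f y by (auto simp: g_def intro: prod_nonneg)
  have expect_g: "expect N (g f) = v t x" if f: "f \<in> ?I" for f
  proof -
    have "inj_on f {1..t}" "f ` {1..t} \<subseteq> {1..N}" using f by auto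
    then obtain \<sigma> where \<sigma>: "\<sigma> permutes {1..N}" "\<And>s. s \<in> {1..t} \<Longrightarrow> \<sigma> s = f s"
      using assms by (rule permutes_extend) blast
    have of_bool_prod: "(\<Prod>s\<in>S. of_bool (P s) :: real) = of_bool (\<forall>s\<in>S. P s)" if "finite S" for S :: "nat set" and P
      using that by induction auto
    have "g f y = of_bool (\<forall>s\<in>{1..t}. (y \<circ> \<sigma>) s = x s)" for y
      using \<sigma>(2) by (simp add: g_def of_bool_prod)
    then have "g f = (\<lambda>y. of_bool (\<forall>s\<in>{1..t}. (y \<circ> \<sigma>) s = x s))" by (rule ext)
    then have "expect N (g f) = expect N (\<lambda>y. of_bool (\<forall>s\<in>{1..t}. y s = x s))"
      using expect_perm[OF \<sigma>(1), of "\<lambda>y. of_bool (\<forall>s\<in>{1..t}. y s = x s)"] by simp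
    then show ?thesis by (simp only: expect_cylinder[OF assms])
  qed
  have "real (N - t) ^ t * v t x \<le> real (card ?I) * v t x"
    using card_injections_ge[OF assms] nonneg
    by (intro mult_right_mono) (auto simp flip: of_nat_power)
  also have "\<dots> = (\<Sum>f\<in>?I. expect N (g f))"
    using expect_g by simp
  also have "\<dots> = expect N (\<lambda>y. \<Sum>f\<in>?I. g f y)"
    by (simp add: expect_sum)
  also have "\<dots> \<le> expect N (\<lambda>_. real N ^ t * bernoulli_lik t x)"
  proof (rule expect_mono)
    fix y
    let ?n = "\<lambda>j. real (symbol_count j N y)"
    \<comment> \<open>Without injectivity the positions are drawn independently, so the sum over all
      \<open>f\<close> factorises over \<open>s\<close>.\<close>
    have "(\<Sum>f\<in>?I. g f y) \<le> (\<Sum>f\<in>{1..t} \<rightarrow>\<^sub>E {1..N}. g f y)"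
      by (rule sum_mono2) (auto simp: finite_PiE g_nonneg)
    also have "\<dots> = (\<Prod>s\<in>{1..t}. \<Sum>i\<in>{1..N}. of_bool (y i = x s))"
      unfolding g_def by (rule prod_sum_PiE[symmetric]) auto
    also have "\<dots> = (\<Prod>s\<in>{1..t}. ?n (x s))"
      by (simp only: sum_symbol_indicator)
    also have "\<dots> = ?n True ^ symbol_count True t x * ?n False ^ symbol_count False t x"
      by (rule prod_symbol_indicator)
    also have "\<dots> \<le> real N ^ t * bernoulli_lik t x"
      using max_lik_maximal[of "?n True" "?n False" "real N" "symbol_count True t x" "symbol_count False t x"]
        symbol_count_add[of N y] symbol_count_add[of t x]
      by (simp add: bernoulli_lik_def flip: of_nat_add)
    finally show "(\<Sum>f\<in>?I. g f y) \<le> real N ^ t * bernoulli_lik t x" .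
  qed
  finally show ?thesis by (simp add: expect_const)
qed

text \<open>With t fixed, the ratio ((N - t)/N)^t tends to 1. That the weights extend to all lengths
  is essential: drawing both balls from an urn with one 0 and one 1 yields the word 01 with
  probability 1/2, above its maximum likelihood 1/4.\<close>

lemma le_bernoulli_lik: "v t x \<le> bernoulli_lik t x"
proof -
  have "(\<lambda>N. (1 - real t / real N) ^ t * v t x) \<longlonglongrightarrow> (1 - 0) ^ t * v t x"
    by (intro tendsto_intros real_tendsto_divide_at_top filterlim_real_sequentially)
  then have "(\<lambda>N. (1 - real t / real N) ^ t * v t x) \<longlonglongrightarrow> v t x" by simp
  then show ?thesis
  proof (rule LIMSEQ_le_const2)
    have "(1 - real t / real N) ^ t * v t x \<le> bernoulli_lik t x" if "N \<ge> Suc t" for N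
    proof -
      have "real N > 0" "1 - real t / real N = real (N - t) / real N"
        using that by (auto simp: field_simps)
      then show ?thesis
        using le_bernoulli_lik_sampling[of t N x] that by (simp add: field_simps)
    qed
    then show "\<exists>M. \<forall>N\<ge>M. (1 - real t / real N) ^ t * v t x \<le> bernoulli_lik t x" by blast
  qed
qed

end

section \<open>Second moment of the pair deviation\<close>

definition frac_ones :: "nat \<Rightarrow> (nat \<Rightarrow> bool) \<Rightarrow> real" where
  "frac_ones t x = real (symbol_count True t x) / real t"

text \<open>The excess of the pairs 11 over what independence predicts from the number of
  transitions out of 1 and the empirical frequency of ones.\<close>

definition pair_dev :: "nat \<Rightarrow> (nat \<Rightarrow> bool) \<Rightarrow> real" where
  "pair_dev t x = real (trans_count True True t x)
     - (real (trans_count True True t x) + real (trans_count False True t x)) * frac_ones t x"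

lemma frac_ones_bounds: "0 \<le> frac_ones t x" "frac_ones t x \<le> 1"
proof -
  show "0 \<le> frac_ones t x" by (simp add: frac_ones_def)
  have "symbol_count True t x \<le> t" using symbol_count_add[of t x] by simp
  then show "frac_ones t x \<le> 1" by (cases "t = 0") (auto simp: frac_ones_def)
qed

lemma pair_dev_eq_sum:
  "pair_dev t x = (\<Sum>s\<in>{2..t}. of_bool (x (s - 1)) * (of_bool (x s) - frac_ones t x))"
proof -
  have step: "{2..Suc n} = insert (Suc n) {2..n}" if "n \<ge> 1" for n
    using that by auto
  \<comment> \<open>The frequency is generalised to a constant \<open>c\<close>, since
    \<open>frac_ones t x\<close> itself changes with \<open>t\<close> and would block the
    induction.\<close>
  have "(\<Sum>s\<in>{2..n}. of_bool (x (s - 1)) * (of_bool (x s) - c))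
      = real (trans_count True True n x) - (real (trans_count True True n x) + real (trans_count False True n x)) * c" for n c
  proof (cases "n = 0")
    case False
    then have "n \<ge> 1" by simp
    then show ?thesis
      by (induction n rule: nat_induct_at_least) (auto simp: trans_count_1 trans_count_Suc step algebra_simps)
  qed (simp add: trans_count_1)
  then show ?thesis by (simp add: pair_dev_def)
qed

lemma symbol_count_permutes:
  assumes "\<sigma> permutes {1..t}"
  shows "symbol_count j t (x \<circ> \<sigma>) = symbol_count j t x"
proof -
  have "{s \<in> {1..t}. x s = j} = \<sigma> ` {s \<in> {1..t}. (x \<circ> \<sigma>) s = j}" (is "?A = \<sigma> ` ?B")
  proof (intro equalityI subsetI)
    fix s assume s: "s \<in> ?A"
    then have "s \<in> \<sigma> ` {1..t}" using permutes_image[OF assms] by simp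
    then show "s \<in> \<sigma> ` ?B" using s by auto
  next
    fix s assume "s \<in> \<sigma> ` ?B"
    then show "s \<in> ?A" using permutes_in_image[OF assms] by auto
  qed
  moreover have "inj_on \<sigma> ?B"
    using permutes_inj[OF assms] by (rule inj_on_subset) simp
  ultimately show ?thesis
    unfolding symbol_count_def by (simp add: card_image)
qed

context exchangeable_weights
begin

text \<open>
  By exchangeability \<open>d\<close> may be averaged over all indices outside \<open>{a, b, c}\<close>, and the \<open>\<xi> i\<close>
  sum to zero over \<open>{1..t}\<close>.
\<close>

lemma expect_product_le:
  assumes distinct: "distinct [a, b, c, d]" and mem: "{a, b, c, d} \<subseteq> {1..t}"
  defines "\<xi> \<equiv> \<lambda>i x. of_bool (x i) - frac_ones t x"
  shows "(real t - 3) * expect t (\<lambda>x. of_bool (x a) * \<xi> b x * (of_bool (x c) * \<xi> d x)) \<le> 3"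
proof -
  let ?S = "{1..t} - {a, b, c}"
  let ?h = "\<lambda>e x. of_bool (x a) * \<xi> b x * (of_bool (x c) * \<xi> e x)"
  have \<xi>_le: "\<bar>\<xi> i x\<bar> \<le> 1" for i x
    using frac_ones_bounds[of t x] by (auto simp: \<xi>_def)
  have swap: "expect t (?h e) = expect t (?h d)" if "e \<in> ?S" for e
  proof -
    let ?\<sigma> = "Transposition.transpose d e"
    have \<sigma>: "?\<sigma> permutes {1..t}"
      using that mem by (intro permutes_swap_id) auto
    have "?h d (x \<circ> ?\<sigma>) = ?h e x" for x
      using distinct that symbol_count_permutes[OF \<sigma>]
      by (simp add: \<xi>_def frac_ones_def)
    then show ?thesis using expect_perm[OF \<sigma>, of "?h d"] by simp
  qed
  have card: "real (card ?S) = real t - 3"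
  proof -
    have "card {a, b, c} \<le> card {1..t}" using mem by (intro card_mono) auto
    then show ?thesis
      using distinct mem by (subst card_Diff_subset) auto
  qed
  have "(real t - 3) * expect t (?h d) = (\<Sum>e\<in>?S. expect t (?h e))"
    using swap by (simp add: card[symmetric])
  also have "\<dots> = expect t (\<lambda>x. \<Sum>e\<in>?S. ?h e x)"
    by (simp add: expect_sum)
  also have "\<dots> \<le> expect t (\<lambda>_. 3)"
  proof (rule expect_mono)
    fix x
    have "(\<Sum>e\<in>{1..t}. \<xi> e x) = real (symbol_count True t x) - real t * frac_ones t x"
      using sum_symbol_indicator[where t = t and x = x and j = True] by (simp add: \<xi>_def sum_subtractf)
    also have "\<dots> = 0"
      using mem by (cases "t = 0") (auto simp: frac_ones_def)
    finally have "(\<Sum>e\<in>?S. \<xi> e x) = - (\<Sum>e\<in>{a, b, c}. \<xi> e x)"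
      using sum.subset_diff[of "{a, b, c}" "{1..t}" "\<lambda>e. \<xi> e x"] mem by simp
    also have "\<bar>\<dots>\<bar> \<le> 3"
      using distinct \<xi>_le[of a x] \<xi>_le[of b x] \<xi>_le[of c x] by simp
    finally have bound: "\<bar>\<Sum>e\<in>?S. \<xi> e x\<bar> \<le> 3" .
    have "(\<Sum>e\<in>?S. ?h e x) = (of_bool (x a) * \<xi> b x * of_bool (x c)) * (\<Sum>e\<in>?S. \<xi> e x)"
      by (simp add: sum_distrib_left mult.assoc)
    also have "\<dots> \<le> \<bar>of_bool (x a) * \<xi> b x * of_bool (x c)\<bar> * \<bar>\<Sum>e\<in>?S. \<xi> e x\<bar>"
      by (metis abs_ge_self abs_mult)
    also have "\<dots> \<le> 1 * 3"
      using \<xi>_le[of b x] bound by (intro mult_mono) (auto simp: abs_mult)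
    finally show "(\<Sum>e\<in>?S. ?h e x) \<le> 3" by simp
  qed
  finally show ?thesis by (simp add: expect_const)
qed

text \<open>Expand the square. For each s at most three indices s' share a position with it, each
  contributing at most 1. All others involve four distinct positions and contribute at most 3/(t -
  3), which is at most 6/t exactly from t = 6 on. Thus each s accounts for at most 3 + 6 =
  9.\<close>

lemma expect_pair_dev_square:
  assumes "t \<ge> 6"
  shows "expect t (\<lambda>x. (pair_dev t x)\<^sup>2) \<le> 9 * real t"
proof -
  define Y where "Y s x = of_bool (x (s - 1)) * (of_bool (x s) - frac_ones t x)" for s x
  have Y_le: "\<bar>Y s x\<bar> \<le> 1" for s x
    using frac_ones_bounds[of t x] by (auto simp: Y_def)
  have pair: "expect t (\<lambda>x. Y s x * Y s' x) \<le> of_bool (s' \<in> {s - 1, s, s + 1}) + 6 / real t"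
    if "s \<in> {2..t}" "s' \<in> {2..t}" for s s'
  proof (cases "s' \<in> {s - 1, s, s + 1}")
    case True
    have "Y s x * Y s' x \<le> 1" for x
    proof -
      have "\<bar>Y s x * Y s' x\<bar> \<le> 1 * 1"
        unfolding abs_mult by (intro mult_mono Y_le) auto
      then show ?thesis by simp
    qed
    then have "expect t (\<lambda>x. Y s x * Y s' x) \<le> expect t (\<lambda>_. 1)"
      by (intro expect_mono)
    then show ?thesis using True by (simp add: expect_const add_increasing2)
  next
    case False
    have dist: "distinct [s - 1, s, s' - 1, s']" "{s - 1, s, s' - 1, s'} \<subseteq> {1..t}"
      using False that by auto
    have "(real t - 3) * expect t (\<lambda>x. Y s x * Y s' x) \<le> 3"
      using expect_product_le[OF dist] by (simp add: Y_def)
    then have "expect t (\<lambda>x. Y s x * Y s' x) \<le> 3 / (real t - 3)"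
      using assms by (simp add: field_simps)
    also have "\<dots> \<le> 6 / real t" using assms by (simp add: field_simps)
    finally show ?thesis using False by simp
  qed
  have "expect t (\<lambda>x. (pair_dev t x)\<^sup>2) = (\<Sum>s\<in>{2..t}. \<Sum>s'\<in>{2..t}. expect t (\<lambda>x. Y s x * Y s' x))"
    unfolding pair_dev_eq_sum Y_def[symmetric] power2_eq_square sum_product by (simp add: expect_sum)
  also have "\<dots> \<le> (\<Sum>s\<in>{2..t}. \<Sum>s'\<in>{2..t}. of_bool (s' \<in> {s - 1, s, s + 1}) + 6 / real t)"
    by (intro sum_mono pair)
  also have "\<dots> \<le> (\<Sum>s\<in>{2..t}. 9)"
  proof (rule sum_mono)
    fix s
    have "(\<Sum>s'\<in>{2..t}. of_bool (s' \<in> {s - 1, s, s + 1}) :: real) = real (card ({2..t} \<inter> {s - 1, s, s + 1}))"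
      by (simp add: of_bool_def sum.If_cases Int_def conj_disj_distribL)
    also have "card ({2..t} \<inter> {s - 1, s, s + 1}) \<le> card {s - 1, s, s + 1}"
      by (intro card_mono) auto
    also have "\<dots> \<le> 3" by (rule card_insert_le_m1 | simp add: card_insert_if)+
    finally have "(\<Sum>s'\<in>{2..t}. of_bool (s' \<in> {s - 1, s, s + 1}) :: real) \<le> 3" by simp
    moreover have "(\<Sum>s'\<in>{2..t}. 6 / real t) \<le> 6"
      using assms by (simp add: field_simps)
    ultimately show "(\<Sum>s'\<in>{2..t}. of_bool (s' \<in> {s - 1, s, s + 1}) + 6 / real t) \<le> 9"
      by (simp add: sum.distrib)
  qed
  also have "\<dots> \<le> 9 * real t" using assms by simp
  finally show ?thesis .
qed

text \<open>
  The first summand covers the words in which the symbol is present but misses the first \<open>m\<close>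
  positions; by exchangeability each of these positions carries a rare symbol with probability at most \<open>\<kappa>\<close>.
\<close>

lemma expect_few_symbols:
  assumes "m \<le> t" "0 \<le> \<kappa>" "t \<ge> 1"
  shows "expect t (\<lambda>x. of_bool (0 < symbol_count j t x \<and> real (symbol_count j t x) < \<kappa> * real t))
     \<le> (v m (\<lambda>_. \<not> j) - v t (\<lambda>_. \<not> j)) + real m * \<kappa>"
proof -
  let ?B = "\<lambda>x. real (symbol_count j t x) < \<kappa> * real t"
  let ?none = "\<lambda>n x. \<forall>s\<in>{1..n}. x s = (\<not> j)"
  let ?e = "\<lambda>s. expect t (\<lambda>x. of_bool (x s = j \<and> ?B x))"
  have none: "symbol_count j n x = 0 \<longleftrightarrow> ?none n x" for n x
    by (auto simp: symbol_count_def)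
  have e_eq: "?e s = ?e s'" if "s \<in> {1..t}" "s' \<in> {1..t}" for s s'
  proof -
    have \<sigma>: "Transposition.transpose s s' permutes {1..t}" using that by (rule permutes_swap_id)
    show ?thesis
      using expect_perm[OF \<sigma>, of "\<lambda>x. of_bool (x s' = j \<and> ?B x)"]
      by (simp add: symbol_count_permutes[OF \<sigma>])
  qed
  have e_le: "?e s \<le> \<kappa>" if "s \<in> {1..t}" for s
  proof -
    \<comment> \<open>Equal terms turn the sum into t times one of them, while the sum itself is the
      expected number of occurrences of \<open>j\<close> on \<open>?B\<close>.\<close>
    have "(\<Sum>s'\<in>{1..t}. ?e s') = (\<Sum>s'\<in>{1..t}. ?e s)"
      using e_eq[OF that] by (intro sum.cong) (auto simp: that)
    then have "real t * ?e s = (\<Sum>s'\<in>{1..t}. ?e s')"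
      by simp
    also have "\<dots> = expect t (\<lambda>x. \<Sum>s'\<in>{1..t}. of_bool (x s' = j \<and> ?B x))"
      by (rule expect_sum[symmetric])
    also have "\<dots> \<le> expect t (\<lambda>_. \<kappa> * real t)"
    proof (rule expect_mono)
      fix x
      show "(\<Sum>s'\<in>{1..t}. of_bool (x s' = j \<and> ?B x)) \<le> \<kappa> * real t"
        using sum_symbol_indicator[where t = t and x = x and j = j] assms by (cases "?B x") auto
    qed
    finally show ?thesis using assms by (simp add: expect_const)
  qed
  have "expect t (\<lambda>x. of_bool (0 < symbol_count j t x \<and> ?B x))
      \<le> expect t (\<lambda>x. (of_bool (?none m x) - of_bool (?none t x)) + (\<Sum>s\<in>{1..m}. of_bool (x s = j \<and> ?B x)))"
  proof (rule expect_mono)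
    fix x
    have sum_nonneg: "(\<Sum>s\<in>{1..m}. of_bool (x s = j \<and> ?B x) :: real) \<ge> 0" by (intro sum_nonneg) auto
    have "(\<Sum>s\<in>{1..m}. of_bool (x s = j \<and> ?B x) :: real) \<ge> 1" if occurs: "\<not> ?none m x" and "?B x"
    proof -
      obtain s where "s \<in> {1..m}" "x s \<noteq> (\<not> j)" using occurs by blast
      then have "s \<in> {1..m}" "x s = j" by auto
      then show ?thesis
        using \<open>?B x\<close> member_le_sum[of s "{1..m}" "\<lambda>s. of_bool (x s = j \<and> ?B x) :: real"] by simp
    qed
    moreover have "?none t x \<Longrightarrow> ?none m x" using assms(1) by auto
    ultimately show "of_bool (0 < symbol_count j t x \<and> ?B x)
        \<le> (of_bool (?none m x) - of_bool (?none t x)) + (\<Sum>s\<in>{1..m}. of_bool (x s = j \<and> ?B x) :: real)"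
      using sum_nonneg none[of t x] by (cases "?none t x"; cases "?none m x"; cases "?B x") auto
  qed
  also have "\<dots> = (v m (\<lambda>_. \<not> j) - v t (\<lambda>_. \<not> j)) + (\<Sum>s\<in>{1..m}. ?e s)"
    by (simp only: expect_add expect_diff expect_sum expect_cylinder[OF assms(1), of "\<lambda>_. \<not> j"]
        expect_cylinder[OF order_refl, of t "\<lambda>_. \<not> j"])
  also have "(\<Sum>s\<in>{1..m}. ?e s) \<le> real m * \<kappa>"
    using sum_bounded_above[of "{1..m}" ?e \<kappa>] e_le assms(1) by simp
  finally show ?thesis by simp
qed

lemma constant_word_convergent: "convergent (\<lambda>m. v m (\<lambda>_. j))"
proof -
  have "v (Suc m) (\<lambda>_. j) \<le> v m (\<lambda>_. j)" for m
  proof -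
    have "(\<lambda>_. j)(Suc m := j) = (\<lambda>_. j)" by auto
    then show ?thesis
      using split[of m "\<lambda>_. j"] nonneg[of "Suc m" "(\<lambda>_. j)(Suc m := \<not> j)"] by (cases j) auto
  qed
  then have "decseq (\<lambda>m. v m (\<lambda>_. j))" by (simp add: decseq_Suc_iff)
  then show ?thesis
    using decseq_bounded[of _ 0] nonneg by (intro Bseq_monoseq_convergent decseq_imp_monoseq) auto
qed

text \<open>The law may charge the constant sequence, so the masses themselves need not become
  small. For m \<le> t the difference is the mass of the words that are constant up to m but not up
  to t.\<close>

lemma constant_word_tail:
  assumes "\<epsilon> > 0"
  shows "\<exists>m0. \<forall>m\<ge>m0. \<forall>t\<ge>m0. v m (\<lambda>_. j) - v t (\<lambda>_. j) < \<epsilon>"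
proof -
  have "Cauchy (\<lambda>m. v m (\<lambda>_. j))" using constant_word_convergent by (rule convergent_Cauchy)
  from CauchyD[OF this assms] show ?thesis by fastforce
qed

end

section \<open>Separating exchangeable weights from the Markov mixture\<close>

text \<open>
  The exponent is the \<open>\<chi>\<^sup>2\<close> statistic for the hypothesis that the success probability is \<open>q\<close>.
\<close>

lemma max_lik_le_chi_square:
  fixes q :: real
  assumes "0 < q" "q < 1" "a + b > 0"
  defines "r \<equiv> real (a + b)"
  shows "max_lik a b \<le> exp ((real a - r * q)\<^sup>2 / (r * (q * (1 - q)))) * (q ^ a * (1 - q) ^ b)"
proof -
  have r: "r > 0" using assms(3) by (simp only: r_def of_nat_0_less_iff)
  have power_bound: "z ^ n \<le> exp (real n * (z - 1))" if "z \<ge> 0" for z :: real and n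
  proof -
    have "z \<le> exp (z - 1)" using exp_ge_add_one_self[of "z - 1"] by simp
    then have "z ^ n \<le> exp (z - 1) ^ n" using that by (rule power_mono)
    then show ?thesis by (simp add: exp_of_nat_mult)
  qed
  have "max_lik a b = (real a / (r * q)) ^ a * (real b / (r * (1 - q))) ^ b * (q ^ a * (1 - q) ^ b)"
    using assms(1,2) by (simp add: max_lik_def r_def power_mult_distrib power_divide)
  also have "\<dots> \<le> exp (real a * (real a / (r * q) - 1)) * exp (real b * (real b / (r * (1 - q)) - 1)) * (q ^ a * (1 - q) ^ b)"
    using assms(1,2) r by (intro mult_right_mono mult_mono power_bound) auto
  also have "exp (real a * (real a / (r * q) - 1)) * exp (real b * (real b / (r * (1 - q)) - 1))
      = exp ((real a - r * q)\<^sup>2 / (r * (q * (1 - q))))"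
  proof -
    \<comment> \<open>In terms of d the two summands are d + d^2/(r q) and -d + d^2/(r (1 - q)), so
      the linear parts cancel.\<close>
    define d where "d = real a - r * q"
    have "real a = r * q + d" "real b = r * (1 - q) - d"
      by (simp_all add: d_def r_def algebra_simps)
    then have "real a * (real a / (r * q) - 1) + real b * (real b / (r * (1 - q)) - 1) = d\<^sup>2 / (r * (q * (1 - q)))"
      using assms(1,2) r by (simp add: divide_simps) (simp add: algebra_simps power2_eq_square)
    then show ?thesis by (simp add: d_def exp_add[symmetric])
  qed
  finally show ?thesis .
qed

text \<open>Each row pays (\<kappa> t)^(-1/2) for its mixture, the Bernoulli mixture only (t +
  1)^(-1/2); this leaves sqrt(t + 1)/t. The maximum likelihoods agree up to the exponentials of two
  bounded \<chi>^2 statistics, with exponents 2K/\<kappa>^3 and 2(2K + 2)/\<kappa>^3. The number 6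
  collects an error 2 from each of three Krichevsky-Trofimov bounds; of the factors 1/\<kappa>, one
  comes from the two square roots and one from the first symbol.\<close>

lemma markov_mix_le_bernoulli_mix:
  fixes \<kappa> K :: real
  assumes \<kappa>: "0 < \<kappa>" and K: "0 \<le> K" and t: "2 \<le> \<kappa> * real t" "t \<ge> 1"
    and n1: "\<kappa> * real t \<le> real (symbol_count True t x)"
    and n0: "\<kappa> * real t \<le> real (symbol_count False t x)"
    and dev: "(pair_dev t x)\<^sup>2 \<le> K * real t"
  shows "markov_mix t x \<le> exp (6 + (6 * K + 4) / \<kappa> ^ 3) / \<kappa>\<^sup>2 * (sqrt (real t + 1) / real t) * bernoulli_mix t x"
proof -
  define q where "q = frac_ones t x"
  let ?c = "\<lambda>j i. trans_count j i t x"
  let ?n = "\<lambda>i. symbol_count i t x"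
  define r where "r i = real (?c True i + ?c False i)" for i
  define d where "d i = real (?c True i) - r i * q" for i
  have sum_n: "real (?n True) + real (?n False) = real t"
    by (metis of_nat_add symbol_count_add)
  have q: "\<kappa> \<le> q" "\<kappa> \<le> 1 - q"
    using n1 n0 t(2) sum_n by (auto simp: q_def frac_ones_def field_simps)
  then have q01: "0 < q" "q < 1" using \<kappa> by auto
  have qn: "q * real t = real (?n True)" using t(2) by (simp add: q_def frac_ones_def)
  have n_ge: "\<kappa> * real t \<le> real (?n i)" for i using n1 n0 by (cases i) auto
  \<comment> \<open>The final position starts no transition, so a row may be one short; 2 \<le>
    \<kappa> t absorbs the loss at the price of a factor 2.\<close>
  have r_ge1: "\<kappa> * real t \<le> r i + 1" and r_ge2: "\<kappa> * real t / 2 \<le> r i" for i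
    using trans_count_row_sum[OF t(2), of i x] n_ge[of i] t(1)
    by (auto simp: r_def of_bool_def split: if_splits)
  have r_pos: "r i > 0" for i using r_ge2[of i] t(1) by linarith
  have col1: "real (?c True True) + real (?c True False) + of_bool (x 1) = real (?n True)"
    using trans_count_column_sum[OF t(2), of True x] by (auto simp: of_bool_def split: if_splits)
  have col0: "real (?c False True) + real (?c False False) + of_bool (\<not> x 1) = real (?n False)"
    using trans_count_column_sum[OF t(2), of False x] by (auto simp: of_bool_def split: if_splits)
  have d1: "(d True)\<^sup>2 \<le> K * real t"
    using dev by (simp add: d_def r_def pair_dev_def q_def)
  \<comment> \<open>The hypothesis controls only the row of 1. The row deviations sum to q -
    [x_1 = 1], by the column sum of 1, so the row of 0 follows.\<close>
  have d_sum: "\<bar>d True + d False\<bar> \<le> 1"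
  proof -
    have r_sum: "r True + r False = real t - 1"
      using col1 col0 sum_n by (auto simp: r_def of_bool_def split: if_splits)
    have "d True + d False = real (?c True True) + real (?c True False) - (r True + r False) * q"
      by (simp add: d_def algebra_simps)
    also have "\<dots> = q - of_bool (x 1)"
      unfolding r_sum using col1 qn by (simp add: algebra_simps)
    finally show ?thesis using q01 by (auto simp: of_bool_def)
  qed
  have d0: "(d False)\<^sup>2 \<le> (2 * K + 2) * real t"
  proof -
    have "\<bar>d False\<bar> \<le> \<bar>d True\<bar> + 1" using d_sum by linarith
    then have "(d False)\<^sup>2 \<le> (\<bar>d True\<bar> + 1)\<^sup>2" by (metis abs_ge_zero power2_abs power_mono)
    also have "\<dots> \<le> 2 * (d True)\<^sup>2 + 2"
      using sum_squares_bound[of "\<bar>d True\<bar>" 1] by (simp add: power2_sum)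
    also have "\<dots> \<le> 2 * (K * real t) + 2 * real t" using d1 t(2) by linarith
    finally show ?thesis by (simp add: algebra_simps)
  qed
  have denom: "\<kappa> ^ 3 * real t / 2 \<le> r i * (q * (1 - q))" for i
  proof -
    have "(\<kappa> * real t / 2) * (\<kappa> * \<kappa>) \<le> r i * (q * (1 - q))"
      using r_ge2 q \<kappa> by (intro mult_mono) (auto intro: less_imp_le[OF r_pos])
    then show ?thesis by (simp add: power3_eq_cube mult_ac)
  qed
  have chi: "(d i)\<^sup>2 / (r i * (q * (1 - q))) \<le> M * 2 / \<kappa> ^ 3" if "(d i)\<^sup>2 \<le> M * real t" for i M
  proof -
    have "M * real t \<ge> 0" using that zero_le_power2 order_trans by blast
    have "(d i)\<^sup>2 / (r i * (q * (1 - q))) \<le> M * real t / (\<kappa> ^ 3 * real t / 2)"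
      using \<kappa> t(2) denom[of i] by (intro frac_le that \<open>M * real t \<ge> 0\<close>) auto
    then show ?thesis using t(2) by (simp add: field_simps)
  qed
  have row: "max_lik (?c False i) (?c True i)
      \<le> exp ((d i)\<^sup>2 / (r i * (q * (1 - q)))) * (q ^ ?c True i * (1 - q) ^ ?c False i)" for i
  proof -
    have "?c True i + ?c False i > 0" using r_pos[of i] by (simp only: r_def of_nat_0_less_iff)
    from max_lik_le_chi_square[OF q01 this] show ?thesis
      unfolding max_lik_swap[of "?c False i"] d_def r_def .
  qed
  have "max_lik (?c False False) (?c True False) * max_lik (?c False True) (?c True True)
      \<le> (exp ((d False)\<^sup>2 / (r False * (q * (1 - q)))) * (q ^ ?c True False * (1 - q) ^ ?c False False))
        * (exp ((d True)\<^sup>2 / (r True * (q * (1 - q)))) * (q ^ ?c True True * (1 - q) ^ ?c False True))"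
    using q01 by (intro mult_mono row less_imp_le[OF max_lik_pos] mult_nonneg_nonneg) auto
  also have "\<dots> = exp ((d False)\<^sup>2 / (r False * (q * (1 - q))) + (d True)\<^sup>2 / (r True * (q * (1 - q))))
       * (q ^ (?c True True + ?c True False) * (1 - q) ^ (?c False True + ?c False False))"
    by (simp add: exp_add power_add mult_ac)
  also have "\<dots> \<le> exp ((6 * K + 4) / \<kappa> ^ 3) * (bernoulli_lik t x / \<kappa>)"
  proof (intro mult_mono)
    have "(2 * K + 2) * 2 / \<kappa> ^ 3 + K * 2 / \<kappa> ^ 3 = (6 * K + 4) / \<kappa> ^ 3"
      by (simp add: algebra_simps flip: add_divide_distrib)
    then show "exp ((d False)\<^sup>2 / (r False * (q * (1 - q))) + (d True)\<^sup>2 / (r True * (q * (1 - q)))) \<le> exp ((6 * K + 4) / \<kappa> ^ 3)"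
      using chi[OF d0] chi[OF d1] by simp
    have lik: "bernoulli_lik t x = q ^ ?n True * (1 - q) ^ ?n False"
    proof -
      have "real (?n False) / real t = 1 - q"
        using sum_n t(2) by (simp add: q_def frac_ones_def field_simps)
      then show ?thesis
        using symbol_count_add[of t x] by (simp add: bernoulli_lik_def max_lik_def q_def frac_ones_def)
    qed
    let ?P = "q ^ (?c True True + ?c True False) * (1 - q) ^ (?c False True + ?c False False)"
    have P: "?P \<ge> 0" using q01 by simp
    \<comment> \<open>The first symbol enters the Bernoulli likelihood but is the target of no
      transition; its probability is at least \<kappa>.\<close>
    have "bernoulli_lik t x = (if x 1 then q else 1 - q) * ?P"
      unfolding lik using trans_count_column_sum[OF t(2), of True x, symmetric] trans_count_column_sum[OF t(2), of False x, symmetric]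
      by simp
    also have "\<dots> \<ge> \<kappa> * ?P" using q P by (intro mult_right_mono) auto
    finally show "?P \<le> bernoulli_lik t x / \<kappa>" using \<kappa> by (simp add: field_simps)
  qed (use q01 in auto)
  finally have ml: "max_lik (?c False False) (?c True False) * max_lik (?c False True) (?c True True)
      \<le> exp ((6 * K + 4) / \<kappa> ^ 3) * (bernoulli_lik t x / \<kappa>)" .
  have kt: "kt_prob (?c False i) (?c True i) \<le> exp 2 * max_lik (?c False i) (?c True i) / sqrt (\<kappa> * real t)" for i
  proof -
    have "sqrt (\<kappa> * real t) \<le> sqrt (real (?c False i + ?c True i) + 1)"
      using r_ge1[of i] by (simp add: r_def add.commute)
    then have "exp 2 * max_lik (?c False i) (?c True i) / sqrt (real (?c False i + ?c True i) + 1)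
       \<le> exp 2 * max_lik (?c False i) (?c True i) / sqrt (\<kappa> * real t)"
      using \<kappa> t(2) by (intro divide_left_mono mult_nonneg_nonneg mult_pos_pos less_imp_le[OF max_lik_pos]) auto
    then show ?thesis
      using kt_prob_max_lik_bounds(1)[of "?c False i" "?c True i"] by linarith
  qed
  have "kt_prob (?c False False) (?c True False) * kt_prob (?c False True) (?c True True)
      \<le> (exp 2 * max_lik (?c False False) (?c True False) / sqrt (\<kappa> * real t))
        * (exp 2 * max_lik (?c False True) (?c True True) / sqrt (\<kappa> * real t))"
    using \<kappa> by (intro mult_mono kt divide_nonneg_nonneg mult_nonneg_nonneg less_imp_le[OF kt_prob_pos] less_imp_le[OF max_lik_pos]) auto
  then have "markov_mix t x \<le> (exp 2 * max_lik (?c False False) (?c True False) / sqrt (\<kappa> * real t))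
      * (exp 2 * max_lik (?c False True) (?c True True) / sqrt (\<kappa> * real t)) / 2"
    unfolding markov_mix_def using t(2) by (simp add: divide_right_mono)
  also have "\<dots> = exp 4 / (2 * \<kappa> * real t) * (max_lik (?c False False) (?c True False) * max_lik (?c False True) (?c True True))"
  proof -
    have "sqrt (\<kappa> * real t) * sqrt (\<kappa> * real t) = \<kappa> * real t"
      using \<kappa> by simp
    moreover have "exp 2 * exp 2 = (exp 4 :: real)" by (simp add: exp_add[symmetric])
    moreover have "(e * u / s) * (e * w / s) / 2 = (e * e) / (2 * (s * s)) * (u * w)" for e u w s :: real
      by (simp add: mult_ac)
    ultimately show ?thesis by (simp only: mult.assoc)
  qed
  also have "\<dots> \<le> exp 4 / (2 * \<kappa> * real t) * (exp ((6 * K + 4) / \<kappa> ^ 3) * (bernoulli_lik t x / \<kappa>))"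
    using \<kappa> by (intro mult_left_mono ml) auto
  also have "\<dots> \<le> exp 4 / (2 * \<kappa> * real t) * (exp ((6 * K + 4) / \<kappa> ^ 3) * (exp 2 * sqrt (real t + 1) * bernoulli_mix t x / \<kappa>))"
  proof -
    have "exp (- 2) * bernoulli_lik t x / sqrt (real t + 1) \<le> bernoulli_mix t x"
      using kt_prob_max_lik_bounds(2)[of "?n True" "?n False"] symbol_count_add[of t x]
      by (simp add: bernoulli_lik_def bernoulli_mix_def)
    then have "exp 2 * sqrt (real t + 1) * (exp (- 2) * bernoulli_lik t x / sqrt (real t + 1))
        \<le> exp 2 * sqrt (real t + 1) * bernoulli_mix t x"
      by (intro mult_left_mono) auto
    moreover have "exp 2 * sqrt (real t + 1) * (exp (- 2) * bernoulli_lik t x / sqrt (real t + 1)) = bernoulli_lik t x"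
    proof -
      have "sqrt (real t + 1) \<noteq> 0" by (simp add: add_nonneg_eq_0_iff)
      then show ?thesis by (simp add: exp_minus field_simps)
    qed
    ultimately have "bernoulli_lik t x \<le> exp 2 * sqrt (real t + 1) * bernoulli_mix t x"
      by linarith
    then show ?thesis using \<kappa> by (intro mult_left_mono divide_right_mono) auto
  qed
  also have "\<dots> = exp (6 + (6 * K + 4) / \<kappa> ^ 3) / \<kappa>\<^sup>2 * (sqrt (real t + 1) / real t) * bernoulli_mix t x / 2"
  proof -
    have "exp (6 + z) = exp 4 * exp z * exp 2" for z :: real
      by (simp flip: exp_add)
    then show ?thesis by (simp add: power2_eq_square mult_ac)
  qed
  also have "\<dots> \<le> exp (6 + (6 * K + 4) / \<kappa> ^ 3) / \<kappa>\<^sup>2 * (sqrt (real t + 1) / real t) * bernoulli_mix t x"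
  proof -
    have "0 \<le> exp (6 + (6 * K + 4) / \<kappa> ^ 3) / \<kappa>\<^sup>2 * (sqrt (real t + 1) / real t) * bernoulli_mix t x"
      by (intro mult_nonneg_nonneg bernoulli_mix.nonneg) auto
    moreover have "z / 2 \<le> z" if "0 \<le> z" for z :: real using that by simp
    ultimately show ?thesis by blast
  qed
  finally show ?thesis .
qed

text \<open>Only one row is in use, and its maximum likelihood is 1, so the price of mixing over its
  parameter is all that remains.\<close>

lemma markov_mix_constant_word:
  assumes "t \<ge> 1"
  shows "markov_mix t (\<lambda>_. j) \<le> exp 2 / sqrt (real t)"
proof -
  have count: "trans_count j' i t (\<lambda>_. j) = (if j' = j \<and> i = j then t - 1 else 0)" for j' i
  proof -
    have "{s \<in> {2..t}. j = i \<and> j = j'} = (if j' = j \<and> i = j then {2..t} else {})" by auto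
    then show ?thesis by (simp add: trans_count_def)
  qed
  have "kt_prob 0 0 = 1" by (simp add: kt_prob_def)
  then have "markov_mix t (\<lambda>_. j) = kt_prob (t - 1) 0 / 2"
    unfolding markov_mix_def count using assms kt_prob_swap[of 0 "t - 1"] by (cases j) auto
  also have "\<dots> \<le> kt_prob (t - 1) 0" using kt_prob_pos[of "t - 1" 0] by simp
  also have "\<dots> \<le> exp 2 * max_lik (t - 1) 0 / sqrt (real (t - 1 + 0) + 1)"
    by (rule kt_prob_max_lik_bounds)
  also have "\<dots> = exp 2 / sqrt (real t)"
    using assms by (cases "t = 1") (auto simp: max_lik_def)
  finally show ?thesis .
qed

definition regular_word :: "real \<Rightarrow> real \<Rightarrow> nat \<Rightarrow> (nat \<Rightarrow> bool) \<Rightarrow> bool" where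
  "regular_word \<kappa> K t x \<longleftrightarrow> \<kappa> * real t \<le> real (symbol_count True t x)
     \<and> \<kappa> * real t \<le> real (symbol_count False t x) \<and> (pair_dev t x)\<^sup>2 \<le> K * real t"

definition null_typical :: "real \<Rightarrow> real \<Rightarrow> nat \<Rightarrow> (nat \<Rightarrow> bool) \<Rightarrow> bool" where
  "null_typical \<kappa> K t x \<longleftrightarrow> (\<forall>s\<in>{1..t}. x s = True) \<or> (\<forall>s\<in>{1..t}. x s = False) \<or> regular_word \<kappa> K t x"

lemma determined_null_typical: "determined t (null_typical \<kappa> K t)"
proof (rule determinedI)
  fix x y :: "nat \<Rightarrow> bool"
  assume eq: "\<And>s. s \<in> {1..t} \<Longrightarrow> x s = y s"
  have "symbol_count j t x = symbol_count j t y" for j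
    using eq by (rule symbol_count_cong)
  moreover have "trans_count j i t x = trans_count j i t y" for j i
    using eq by (rule trans_count_cong)
  ultimately have "regular_word \<kappa> K t x = regular_word \<kappa> K t y"
    by (simp add: regular_word_def pair_dev_def frac_ones_def)
  moreover have "(\<forall>s\<in>{1..t}. x s = j) = (\<forall>s\<in>{1..t}. y s = j)" for j
    using eq by (intro ball_cong) auto
  ultimately show "null_typical \<kappa> K t x = null_typical \<kappa> K t y"
    unfolding null_typical_def by (simp only:)
qed

text \<open>A union bound. Regular words are compared one by one with the Bernoulli mixture, so
  their number does not enter.\<close>

lemma markov_mix_null_typical:
  assumes \<kappa>: "0 < \<kappa>" and K: "0 \<le> K" and t: "2 \<le> \<kappa> * real t" "t \<ge> 1"
  shows "markov_mix.expect t (\<lambda>x. of_bool (null_typical \<kappa> K t x))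
    \<le> 2 * (exp 2 / sqrt (real t)) + exp (6 + (6 * K + 4) / \<kappa> ^ 3) / \<kappa>\<^sup>2 * (sqrt (real t + 1) / real t)"
    (is "_ \<le> _ + ?C")
proof -
  let ?A = "\<lambda>j x. of_bool (\<forall>s\<in>{1..t}. x s = j) :: real"
  have "markov_mix.expect t (\<lambda>x. of_bool (null_typical \<kappa> K t x))
     \<le> markov_mix.expect t (\<lambda>x. (?A True x + ?A False x) + of_bool (regular_word \<kappa> K t x))"
    by (rule markov_mix.expect_mono) (auto simp: null_typical_def)
  also have "\<dots> = markov_mix t (\<lambda>_. True) + markov_mix t (\<lambda>_. False)
      + markov_mix.expect t (\<lambda>x. of_bool (regular_word \<kappa> K t x))"
    by (simp only: markov_mix.expect_add markov_mix.expect_cylinder[OF order_refl, of t "\<lambda>_. True"]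
        markov_mix.expect_cylinder[OF order_refl, of t "\<lambda>_. False"])
  also have "markov_mix.expect t (\<lambda>x. of_bool (regular_word \<kappa> K t x)) \<le> ?C * bernoulli_mix.expect t (\<lambda>_. 1)"
    unfolding markov_mix.expect_def bernoulli_mix.expect_def sum_distrib_left
  proof (rule sum_mono)
    fix x
    have "0 \<le> ?C * (bernoulli_mix t x * 1)"
      by (intro mult_nonneg_nonneg) (auto simp: bernoulli_mix.nonneg)
    then show "markov_mix t x * of_bool (regular_word \<kappa> K t x) \<le> ?C * (bernoulli_mix t x * 1)"
      using markov_mix_le_bernoulli_mix[OF assms, of x]
      by (cases "regular_word \<kappa> K t x") (auto simp: regular_word_def)
  qed
  finally show ?thesis
    using markov_mix_constant_word[OF t(2), of True] markov_mix_constant_word[OF t(2), of False]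
    unfolding bernoulli_mix.expect_one by linarith
qed

context exchangeable_weights
begin

text \<open>In an atypical word both symbols occur, and either one of them is rare or the pair
  deviation is large; Chebyshev's inequality turns the second moment 9 t into 9/K.\<close>

lemma expect_not_null_typical:
  assumes "m \<le> t" "0 \<le> \<kappa>" "t \<ge> 6" "0 < K"
  shows "expect t (\<lambda>x. of_bool (\<not> null_typical \<kappa> K t x))
    \<le> (v m (\<lambda>_. True) - v t (\<lambda>_. True)) + (v m (\<lambda>_. False) - v t (\<lambda>_. False)) + 2 * (real m * \<kappa>) + 9 / K"
proof -
  let ?few = "\<lambda>j x. of_bool (0 < symbol_count j t x \<and> real (symbol_count j t x) < \<kappa> * real t) :: real"
  have none: "symbol_count j t x = 0 \<longleftrightarrow> (\<forall>s\<in>{1..t}. x s = (\<not> j))" for j x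
    by (auto simp: symbol_count_def)
  have Kt: "K * real t > 0" using assms by simp
  have "expect t (\<lambda>x. of_bool (\<not> null_typical \<kappa> K t x))
     \<le> expect t (\<lambda>x. (?few True x + ?few False x) + 1 / (K * real t) * (pair_dev t x)\<^sup>2)"
  proof (rule expect_mono)
    fix x
    have pos: "1 / (K * real t) * (pair_dev t x)\<^sup>2 \<ge> 0" using Kt by simp
    show "of_bool (\<not> null_typical \<kappa> K t x) \<le> (?few True x + ?few False x) + 1 / (K * real t) * (pair_dev t x)\<^sup>2"
    proof (cases "null_typical \<kappa> K t x")
      case True
      then show ?thesis using pos by simp
    next
      case False
      then have "symbol_count True t x > 0" "symbol_count False t x > 0" "\<not> regular_word \<kappa> K t x"
        using none[of True x] none[of False x] by (auto simp: null_typical_def)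
      then consider "?few True x = 1" | "?few False x = 1" | "(pair_dev t x)\<^sup>2 > K * real t"
        by (auto simp: regular_word_def)
      then show ?thesis
      proof cases
        case 3
        then have "1 / (K * real t) * (pair_dev t x)\<^sup>2 \<ge> 1" using Kt by (simp add: field_simps)
        then show ?thesis using False by (simp add: add_increasing)
      qed (use pos False in \<open>auto intro: add_increasing2 add_nonneg_nonneg\<close>)
    qed
  qed
  also have "\<dots> = expect t (?few True) + expect t (?few False) + 1 / (K * real t) * expect t (\<lambda>x. (pair_dev t x)\<^sup>2)"
    by (simp only: expect_add expect_scale)
  also have "1 / (K * real t) * expect t (\<lambda>x. (pair_dev t x)\<^sup>2) \<le> 1 / (K * real t) * (9 * real t)"
    using Kt assms by (intro mult_left_mono expect_pair_dev_square) auto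
  also have "1 / (K * real t) * (9 * real t) = 9 / K" using assms by simp
  finally show ?thesis
    using expect_few_symbols[OF assms(1,2), of True] expect_few_symbols[OF assms(1,2), of False] assms(3)
    by simp
qed

lemma separating_test:
  assumes "\<delta> > 0"
  obtains T \<kappa> K where "expect T (\<lambda>x. of_bool (\<not> null_typical \<kappa> K T x)) \<le> \<delta>"
    and "markov_mix.expect T (\<lambda>x. of_bool (null_typical \<kappa> K T x)) \<le> \<delta>"
proof -
  obtain m where m: "\<And>t. t \<ge> m \<Longrightarrow> v m (\<lambda>_. True) - v t (\<lambda>_. True) < \<delta> / 8"
    "\<And>t. t \<ge> m \<Longrightarrow> v m (\<lambda>_. False) - v t (\<lambda>_. False) < \<delta> / 8"
  proof -
    have "\<delta> / 8 > 0" using assms by simp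
    obtain m1 where m1: "\<forall>m\<ge>m1. \<forall>t\<ge>m1. v m (\<lambda>_. True) - v t (\<lambda>_. True) < \<delta> / 8"
      using constant_word_tail[OF \<open>\<delta> / 8 > 0\<close>] by blast
    obtain m2 where m2: "\<forall>m\<ge>m2. \<forall>t\<ge>m2. v m (\<lambda>_. False) - v t (\<lambda>_. False) < \<delta> / 8"
      using constant_word_tail[OF \<open>\<delta> / 8 > 0\<close>] by blast
    show ?thesis
      using m1[rule_format, of "max m1 m2"] m2[rule_format, of "max m1 m2"] by (intro that[of "max m1 m2"]) auto
  qed
  \<comment> \<open>The order of choice matters: \<open>m\<close> depends on the law, \<kappa> on
    \<open>m\<close>, and \<open>T\<close> must finally beat the constant \<open>C\<close>, which
    depends on \<kappa> and \<open>K\<close>. The error terms are at most \<delta>/8 + \<delta>/8 +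
    \<delta>/4 + \<delta>/8.\<close>
  define \<kappa> where "\<kappa> = \<delta> / (8 * (real m + 1))"
  define K where "K = 72 / \<delta>"
  have pos: "\<kappa> > 0" "K > 0" using assms by (auto simp: \<kappa>_def K_def)
  define C where "C = exp (6 + (6 * K + 4) / \<kappa> ^ 3) / \<kappa>\<^sup>2"
  have "(\<lambda>t. 2 * (exp 2 / sqrt (real t)) + C * (sqrt (real t + 1) / real t)) \<longlonglongrightarrow> 2 * 0 + C * 0"
    by (intro tendsto_intros) real_asymp+
  then have "\<forall>\<^sub>F t in sequentially. 2 * (exp 2 / sqrt (real t)) + C * (sqrt (real t + 1) / real t) < \<delta>"
    using assms by (intro order_tendstoD) auto
  moreover have "\<forall>\<^sub>F t in sequentially. 2 / \<kappa> \<le> real t"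
    using eventually_ge_at_top[of "nat \<lceil>2 / \<kappa>\<rceil>"] by eventually_elim linarith
  ultimately have "\<forall>\<^sub>F t in sequentially. 2 * (exp 2 / sqrt (real t)) + C * (sqrt (real t + 1) / real t) < \<delta>
      \<and> 2 / \<kappa> \<le> real t \<and> t \<ge> m \<and> t \<ge> 6"
    using eventually_ge_at_top[of m] eventually_ge_at_top[of 6] by eventually_elim simp
  then obtain T where T: "2 * (exp 2 / sqrt (real T)) + C * (sqrt (real T + 1) / real T) < \<delta>"
    "2 / \<kappa> \<le> real T" "T \<ge> m" "T \<ge> 6"
    by (auto simp: eventually_sequentially)
  show ?thesis
  proof (rule that)
    have "real m * \<kappa> \<le> \<delta> / 8" using assms by (simp add: \<kappa>_def field_simps)
    moreover have "9 / K = \<delta> / 8" using assms by (simp add: K_def)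
    ultimately show "expect T (\<lambda>x. of_bool (\<not> null_typical \<kappa> K T x)) \<le> \<delta>"
      using expect_not_null_typical[OF T(3) less_imp_le[OF pos(1)] T(4) pos(2)] m[OF T(3)] assms by linarith
    have "2 \<le> \<kappa> * real T" using T(2) pos(1) by (simp add: field_simps)
    then show "markov_mix.expect T (\<lambda>x. of_bool (null_typical \<kappa> K T x)) \<le> \<delta>"
      using markov_mix_null_typical[of \<kappa> K T] pos T(1,4) by (simp add: C_def)
  qed
qed

section \<open>Stopped sums and first passages\<close>

lemma R_times_weight_le: "v t x * R t x \<le> markov_mix t x"
proof -
  have "v t x * R t x \<le> bernoulli_lik t x * R t x"
    using R_pos[of t x] by (intro mult_right_mono le_bernoulli_lik) simp
  also have "\<dots> = markov_mix t x" using bernoulli_lik_pos[of t x] by (simp add: R_eq)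
  finally show ?thesis .
qed

text \<open>Multiplying by \<open>R t\<close> replaces the law's weight of a word by at most its
  Markov weight. Consistency moves these weights to the common horizon \<open>N\<close>, where
  disjoint events add up. It serves both for first passages after \<open>T\<close> and for the
  values of a stopping time.\<close>

lemma expect_R_stopped:
  assumes det: "\<And>t. determined t (B t)"
    and disjoint: "\<And>s t x. B s x \<Longrightarrow> B t x \<Longrightarrow> s = t"
  shows "(\<Sum>t\<in>{T..N}. expect t (\<lambda>x. R t x * of_bool (B t x)))
    \<le> markov_mix.expect N (\<lambda>x. of_bool (\<exists>t\<in>{T..N}. B t x))"
proof -
  have "expect t (\<lambda>x. R t x * of_bool (B t x)) \<le> markov_mix.expect N (\<lambda>x. of_bool (B t x))" if "t \<in> {T..N}" for t
  proof -
    have "expect t (\<lambda>x. R t x * of_bool (B t x)) \<le> markov_mix.expect t (\<lambda>x. of_bool (B t x))"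
      unfolding expect_def markov_mix.expect_def
      by (rule sum_mono) (auto simp: R_times_weight_le markov_mix.nonneg)
    also have "\<dots> = markov_mix.expect N (\<lambda>x. of_bool (B t x))"
      using that by (intro markov_mix.expect_marginal[symmetric] determined_comp[OF det]) simp
    finally show ?thesis .
  qed
  then have "(\<Sum>t\<in>{T..N}. expect t (\<lambda>x. R t x * of_bool (B t x)))
      \<le> (\<Sum>t\<in>{T..N}. markov_mix.expect N (\<lambda>x. of_bool (B t x)))"
    by (rule sum_mono)
  also have "\<dots> = markov_mix.expect N (\<lambda>x. \<Sum>t\<in>{T..N}. of_bool (B t x))"
    by (rule markov_mix.expect_sum[symmetric])
  also have "\<dots> \<le> markov_mix.expect N (\<lambda>x. of_bool (\<exists>t\<in>{T..N}. B t x))"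
  proof (rule markov_mix.expect_mono)
    fix x
    show "(\<Sum>t\<in>{T..N}. of_bool (B t x) :: real) \<le> of_bool (\<exists>t\<in>{T..N}. B t x)"
    proof (cases "\<exists>t\<in>{T..N}. B t x")
      case True
      then obtain u where u: "u \<in> {T..N}" "B u x" by blast
      then have "B t x \<longleftrightarrow> t = u" for t using disjoint by blast
      then show ?thesis using u by (simp add: of_bool_def)
    qed simp
  qed
  finally show ?thesis .
qed

text \<open>Markov's inequality at the first passage of \<epsilon> after \<open>T\<close>, confined
  to the typical words \<open>?A\<close>. As \<open>?A\<close> is settled at time \<open>T\<close>,
  its Markov mass does not depend on the horizon \<open>N\<close>. The bound is \<eta> for atypical
  words plus \<eta>/\<epsilon> for passages, which fixes \<eta>.\<close>

lemma expect_R_exceeds: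
  assumes "\<epsilon> > 0" "\<delta> > 0"
  obtains T where "\<And>N. N \<ge> T \<Longrightarrow> expect N (\<lambda>x. of_bool (\<exists>t\<in>{T..N}. \<epsilon> \<le> R t x)) \<le> \<delta>"
proof -
  define \<eta> where "\<eta> = \<delta> / (1 + 1 / \<epsilon>)"
  have "1 + 1 / \<epsilon> > 0" using assms by (simp add: add_pos_pos)
  then have \<eta>: "\<eta> > 0" "\<eta> + \<eta> / \<epsilon> = \<delta>"
    using assms distrib_left[of \<eta> 1 "1 / \<epsilon>"] by (simp_all add: \<eta>_def)
  obtain T \<kappa> K where test: "expect T (\<lambda>x. of_bool (\<not> null_typical \<kappa> K T x)) \<le> \<eta>"
    "markov_mix.expect T (\<lambda>x. of_bool (null_typical \<kappa> K T x)) \<le> \<eta>"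
    using separating_test[OF \<eta>(1)] .
  let ?A = "null_typical \<kappa> K T"
  define B where "B t x \<longleftrightarrow> t \<ge> T \<and> ?A x \<and> \<epsilon> \<le> R t x \<and> (\<forall>s\<in>{T..<t}. R s x < \<epsilon>)" for t x
  \<comment> \<open>Before \<open>T\<close> the event never occurs; from \<open>T\<close> on the
    word already decides \<open>?A\<close>.\<close>
  have det: "determined t (B t)" for t
  proof (cases "t \<ge> T")
    case True
    show ?thesis
    proof (rule determinedI)
      fix x y :: "nat \<Rightarrow> bool"
      assume eq: "\<And>s. s \<in> {1..t} \<Longrightarrow> x s = y s"
      have "?A x = ?A y"
        using eq by (intro determinedD[OF determined_mono[OF determined_null_typical True]])
      moreover have "R s x = R s y" if "s \<le> t" for s
        using eq by (intro determinedD[OF determined_mono[OF determined_R that]])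
      ultimately show "B t x = B t y" by (simp add: B_def)
    qed
  qed (auto simp: B_def determined_def)
  have "\<not> s < t" if "B s x" "B t x" for s t x
  proof
    assume "s < t"
    with that have "s \<in> {T..<t}" "\<epsilon> \<le> R s x" by (auto simp: B_def)
    moreover have "\<forall>s\<in>{T..<t}. R s x < \<epsilon>" using that by (simp add: B_def)
    ultimately show False by fastforce
  qed
  then have disjoint: "s = t" if "B s x" "B t x" for s t x
    using that by (meson linorder_neqE_nat)
  have "expect N (\<lambda>x. of_bool (\<exists>t\<in>{T..N}. \<epsilon> \<le> R t x)) \<le> \<delta>" if "N \<ge> T" for N
  proof -
    have "expect N (\<lambda>x. of_bool (\<exists>t\<in>{T..N}. \<epsilon> \<le> R t x))
       \<le> expect N (\<lambda>x. of_bool (\<not> ?A x) + (\<Sum>t\<in>{T..N}. 1 / \<epsilon> * (R t x * of_bool (B t x))))"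
    proof (rule expect_mono)
      fix x
      have nonneg: "1 / \<epsilon> * (R t x * of_bool (B t x)) \<ge> 0" for t
        using assms(1) R_pos[of t x] by simp
      then have sum_nonneg: "(\<Sum>t\<in>{T..N}. 1 / \<epsilon> * (R t x * of_bool (B t x))) \<ge> 0" by (intro sum_nonneg)
      show "of_bool (\<exists>t\<in>{T..N}. \<epsilon> \<le> R t x)
         \<le> of_bool (\<not> ?A x) + (\<Sum>t\<in>{T..N}. 1 / \<epsilon> * (R t x * of_bool (B t x)))"
      proof (cases "?A x \<and> (\<exists>t\<in>{T..N}. \<epsilon> \<le> R t x)")
        case True
        define t where "t = (LEAST t. T \<le> t \<and> \<epsilon> \<le> R t x)"
        obtain t' where t': "t' \<in> {T..N}" "\<epsilon> \<le> R t' x" using True by blast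
        have t: "T \<le> t" "\<epsilon> \<le> R t x"
          using LeastI[of "\<lambda>t. T \<le> t \<and> \<epsilon> \<le> R t x" t'] t' by (auto simp: t_def)
        have "t \<le> t'" using t' unfolding t_def by (intro Least_le) auto
        have "R s x < \<epsilon>" if "s \<in> {T..<t}" for s
        proof -
          have "s < (LEAST t. T \<le> t \<and> \<epsilon> \<le> R t x)" using that by (simp add: t_def)
          from not_less_Least[OF this] that show ?thesis by simp
        qed
        then have "B t x" using t True by (simp add: B_def)
        then have "1 \<le> 1 / \<epsilon> * (R t x * of_bool (B t x))" using t assms(1) by (simp add: field_simps)
        also have "\<dots> \<le> (\<Sum>t\<in>{T..N}. 1 / \<epsilon> * (R t x * of_bool (B t x)))"
          using t(1) \<open>t \<le> t'\<close> t'(1) by (intro member_le_sum nonneg) auto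
        finally show ?thesis using True by simp
      next
        case False
        then show ?thesis using sum_nonneg by auto
      qed
    qed
    also have "\<dots> = expect N (\<lambda>x. of_bool (\<not> ?A x)) + 1 / \<epsilon> * (\<Sum>t\<in>{T..N}. expect N (\<lambda>x. R t x * of_bool (B t x)))"
      by (simp only: expect_add expect_sum expect_scale sum_distrib_left)
    finally have split: "expect N (\<lambda>x. of_bool (\<exists>t\<in>{T..N}. \<epsilon> \<le> R t x))
      \<le> expect N (\<lambda>x. of_bool (\<not> ?A x)) + 1 / \<epsilon> * (\<Sum>t\<in>{T..N}. expect N (\<lambda>x. R t x * of_bool (B t x)))" .
    have "(\<Sum>t\<in>{T..N}. expect N (\<lambda>x. R t x * of_bool (B t x))) = (\<Sum>t\<in>{T..N}. expect t (\<lambda>x. R t x * of_bool (B t x)))"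
      by (intro sum.cong refl expect_marginal determined_comp2[where H = "\<lambda>r b. r * of_bool b", OF determined_R det]) simp
    also have "\<dots> \<le> markov_mix.expect N (\<lambda>x. of_bool (\<exists>t\<in>{T..N}. B t x))"
      using det disjoint by (rule expect_R_stopped)
    also have "\<dots> \<le> markov_mix.expect N (\<lambda>x. of_bool (?A x))"
      by (rule markov_mix.expect_mono) (auto simp: B_def)
    also have "\<dots> = markov_mix.expect T (\<lambda>x. of_bool (?A x))"
      using that by (intro markov_mix.expect_marginal determined_comp[OF determined_null_typical])
    also have "\<dots> \<le> \<eta>" by (rule test)
    finally have "1 / \<epsilon> * (\<Sum>t\<in>{T..N}. expect N (\<lambda>x. R t x * of_bool (B t x))) \<le> 1 / \<epsilon> * \<eta>"
      using assms(1) by (intro mult_left_mono) auto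
    moreover have "expect N (\<lambda>x. of_bool (\<not> ?A x)) = expect T (\<lambda>x. of_bool (\<not> ?A x))"
      using that by (intro expect_marginal determined_comp[where H = "\<lambda>b. of_bool (\<not> b)", OF determined_null_typical])
    ultimately show ?thesis using split test(1) \<eta>(2) by simp
  qed
  then show ?thesis by (rule that)
qed

end

section \<open>Exchangeable laws\<close>

lemma space_seq_space: "space seq_space = ({1..} \<rightarrow>\<^sub>E UNIV)"
  by (simp add: seq_space_def space_PiM)

lemma space_nat_filt [simp]: "space (nat_filt t) = space seq_space"
  unfolding nat_filt_def by (rule space_measure_of) auto

lemma sets_nat_filt:
  "sets (nat_filt t) = sigma_sets (space seq_space) {{\<omega> \<in> space seq_space. \<omega> s \<in> A} | s A. 1 \<le> s \<and> enat s \<le> t}"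
  unfolding nat_filt_def by (rule sets_measure_of) auto

lemma sets_nat_filt_le: "sets (nat_filt t) \<subseteq> sets seq_space"
  unfolding sets_nat_filt
proof (rule sets.sigma_sets_subset, clarify)
  fix s :: nat and A :: "bool set"
  assume "1 \<le> s"
  then have "(\<lambda>\<omega>. \<omega> s) \<in> seq_space \<rightarrow>\<^sub>M count_space UNIV"
    unfolding seq_space_def by (intro measurable_component_singleton) simp
  from measurable_sets[OF this, of A] show "{\<omega> \<in> space seq_space. \<omega> s \<in> A} \<in> sets seq_space"
    by (simp add: vimage_def Int_def conj_commute)
qed

definition cylinder :: "nat \<Rightarrow> (nat \<Rightarrow> bool) \<Rightarrow> (nat \<Rightarrow> bool) set" where
  "cylinder t x = {\<omega> \<in> space seq_space. \<forall>s\<in>{1..t}. \<omega> s = x s}"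

lemma cylinder_in_nat_filt: "cylinder t x \<in> sets (nat_filt (enat t))"
proof -
  have "{\<omega> \<in> space (nat_filt (enat t)). \<omega> s = x s} \<in> sets (nat_filt (enat t))" if "s \<in> {1..t}" for s
  proof -
    have "{\<omega> \<in> space seq_space. \<omega> s \<in> {x s}} \<in> sets (nat_filt (enat t))"
      unfolding sets_nat_filt using that
      by (intro sigma_sets.Basic CollectI exI[of _ s] exI[of _ "{x s}"]) auto
    then show ?thesis by simp
  qed
  then have "{\<omega> \<in> space (nat_filt (enat t)). \<forall>s\<in>{1..t}. \<omega> s = x s} \<in> sets (nat_filt (enat t))"
    by (intro sets.sets_Collect_finite_All) auto
  then show ?thesis by (simp add: cylinder_def)
qed

lemma cylinder_in_seq_space: "cylinder t x \<in> sets seq_space"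
  using cylinder_in_nat_filt sets_nat_filt_le by blast

text \<open>The cylinders of length t partition the space, so a determined function is a simple
  function. This gives its measurability and turns its integral into \<open>expect\<close>.\<close>

lemma determined_eq_sum_cylinder:
  fixes h :: "(nat \<Rightarrow> bool) \<Rightarrow> real"
  assumes "determined t h" "\<omega> \<in> space seq_space"
  shows "h \<omega> = (\<Sum>x\<in>words t. h x * indicator (cylinder t x) \<omega>)"
proof -
  let ?r = "restrict \<omega> {1..t}"
  have "h \<omega> = h ?r" by (rule determinedD[OF assms(1)]) simp
  also have "\<dots> = (\<Sum>x\<in>words t. if x = ?r then h ?r else 0)"
  proof -
    have "?r \<in> words t" by (simp add: words_def)
    then show ?thesis by simp
  qed
  also have "\<dots> = (\<Sum>x\<in>words t. h x * indicator (cylinder t x) \<omega>)"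
  proof (rule sum.cong[OF refl])
    fix x assume "x \<in> words t"
    then have "\<omega> \<in> cylinder t x \<longleftrightarrow> x = ?r"
      using assms(2) by (auto simp: cylinder_def words_def fun_eq_iff PiE_def extensional_def)
    then show "(if x = ?r then h ?r else 0) = h x * indicator (cylinder t x) \<omega>"
      by (simp add: indicator_def)
  qed
  finally show ?thesis .
qed

lemma determined_measurable:
  fixes h :: "(nat \<Rightarrow> bool) \<Rightarrow> real"
  assumes "determined t h"
  shows "h \<in> borel_measurable (nat_filt (enat t))" and "h \<in> borel_measurable seq_space"
proof -
  have *: "h \<in> borel_measurable M \<longleftrightarrow> (\<lambda>\<omega>. \<Sum>x\<in>words t. h x * indicator (cylinder t x) \<omega>) \<in> borel_measurable M"
    if "space M = space seq_space" for M :: "(nat \<Rightarrow> bool) measure"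
    using determined_eq_sum_cylinder[OF assms] that by (intro measurable_cong) auto
  have [measurable]: "cylinder t x \<in> sets (nat_filt (enat t))" "cylinder t x \<in> sets seq_space" for x
    by (rule cylinder_in_nat_filt, rule cylinder_in_seq_space)
  show "h \<in> borel_measurable (nat_filt (enat t))"
    by (subst *) (simp, measurable)
  show "h \<in> borel_measurable seq_space"
    by (subst *) (simp, measurable)
qed

text \<open>The generators cannot separate two sequences with the same first t symbols, and
  complements and countable unions preserve this. It turns the measurability of a stopping event
  into a statement about words.\<close>

lemma nat_filt_coordinates:
  assumes "A \<in> sets (nat_filt (enat t))"
    and "\<omega> \<in> space seq_space" "\<omega>' \<in> space seq_space" "\<And>s. s \<in> {1..t} \<Longrightarrow> \<omega> s = \<omega>' s"
  shows "\<omega> \<in> A \<longleftrightarrow> \<omega>' \<in> A"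
  using assms(1) unfolding sets_nat_filt
proof (induction rule: sigma_sets.induct)
  case (Basic a)
  then show ?case using assms(2-4) by auto
next
  case (Compl a)
  then show ?case using assms(2,3) by auto
qed auto

section \<open>From weights on words to exchangeable laws\<close>

locale exchangeable_law =
  fixes Q :: "(nat \<Rightarrow> bool) measure"
  assumes Q: "Q \<in> exchangeable_laws"
begin

sublocale prob_space Q
  using Q by (simp add: exchangeable_laws_def)

lemma sets_Q [measurable_cong]: "sets Q = sets seq_space"
  using Q by (simp add: exchangeable_laws_def)

lemma space_Q: "space Q = space seq_space"
  by (rule sets_eq_imp_space_eq[OF sets_Q])

definition word_prob :: "nat \<Rightarrow> (nat \<Rightarrow> bool) \<Rightarrow> real" where
  "word_prob t x = prob (cylinder t x)"

lemma cylinder_event [measurable]: "cylinder t x \<in> events"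
  by (simp add: sets_Q cylinder_in_seq_space)

text \<open>The preimage of a word x under permuting the coordinates by \<rho> is the cylinder of
  \<open>x \<circ> inv \<rho>\<close>, so exchangeability is applied with the inverse of
  \<sigma>.\<close>

lemma word_prob_perm:
  assumes \<sigma>: "\<sigma> permutes {1..t}"
  shows "word_prob t (x \<circ> \<sigma>) = word_prob t x"
proof -
  let ?M = "\<Pi>\<^sub>M s\<in>{1..t}. (count_space UNIV :: bool measure)"
  let ?\<tau> = "inv \<sigma>"
  have \<tau>: "?\<tau> permutes {1..t}" by (rule permutes_inv[OF \<sigma>])
  have coord: "(\<lambda>\<omega>. \<lambda>s\<in>{1..t}. \<omega> (\<rho> s)) \<in> Q \<rightarrow>\<^sub>M ?M" if "\<rho> permutes {1..t}" for \<rho>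
  proof (rule measurable_restrict)
    fix s assume "s \<in> {1..t}"
    then have "\<rho> s \<in> {1..t}" using permutes_in_image[OF that] by blast
    then have "(\<lambda>\<omega>. \<omega> (\<rho> s)) \<in> seq_space \<rightarrow>\<^sub>M count_space UNIV"
      unfolding seq_space_def by (intro measurable_component_singleton) simp
    then show "(\<lambda>\<omega>. \<omega> (\<rho> s)) \<in> Q \<rightarrow>\<^sub>M count_space UNIV"
      by (simp add: measurable_cong_sets[OF sets_Q refl])
  qed
  have point: "{restrict y {1..t}} \<in> sets ?M" for y
  proof -
    have "{restrict y {1..t}} = {z \<in> space ?M. \<forall>s\<in>{1..t}. z s = y s}"
    proof (intro equalityI subsetI)
      fix z assume "z \<in> {z \<in> space ?M. \<forall>s\<in>{1..t}. z s = y s}"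
      then have "z = restrict y {1..t}"
        by (intro extensionalityI[of _ "{1..t}"]) (auto simp: space_PiM PiE_def)
      then show "z \<in> {restrict y {1..t}}" by simp
    qed (auto simp: space_PiM)
    also have "\<dots> \<in> sets ?M" by measurable
    finally show ?thesis .
  qed
  have law: "measure (distr Q ?M (\<lambda>\<omega>. \<lambda>s\<in>{1..t}. \<omega> (\<rho> s))) {restrict x {1..t}} = word_prob t (x \<circ> inv \<rho>)"
    if \<rho>: "\<rho> permutes {1..t}" for \<rho>
  proof -
    have "(\<lambda>\<omega>. \<lambda>s\<in>{1..t}. \<omega> (\<rho> s)) -` {restrict x {1..t}} \<inter> space Q = cylinder t (x \<circ> inv \<rho>)"
    proof -
      have coords: "(\<forall>s\<in>{1..t}. \<omega> (\<rho> s) = x s) \<longleftrightarrow> (\<forall>s\<in>{1..t}. \<omega> s = (x \<circ> inv \<rho>) s)" for \<omega> :: "nat \<Rightarrow> bool"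
        using permutes_in_image[OF \<rho>] permutes_in_image[OF permutes_inv[OF \<rho>]] permutes_inverses[OF \<rho>]
        by (metis comp_apply)
      have point_eq: "restrict (\<lambda>s. \<omega> (\<rho> s)) {1..t} = restrict x {1..t} \<longleftrightarrow> (\<forall>s\<in>{1..t}. \<omega> (\<rho> s) = x s)" for \<omega> :: "nat \<Rightarrow> bool"
      proof
        assume eq: "restrict (\<lambda>s. \<omega> (\<rho> s)) {1..t} = restrict x {1..t}"
        show "\<forall>s\<in>{1..t}. \<omega> (\<rho> s) = x s"
        proof
          fix s assume "s \<in> {1..t}"
          then show "\<omega> (\<rho> s) = x s" using fun_cong[OF eq, of s] by simp
        qed
      qed (rule restrict_ext, blast)
      show ?thesis
        by (rule set_eqI) (simp only: Int_iff vimage_eq singleton_iff cylinder_def mem_Collect_eq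
          space_Q point_eq coords conj_commute)
    qed
    then show ?thesis
      unfolding word_prob_def by (simp only: measure_distr[OF coord[OF \<rho>] point])
  qed
  have "distr Q ?M (\<lambda>\<omega>. \<lambda>s\<in>{1..t}. \<omega> s) = distr Q ?M (\<lambda>\<omega>. \<lambda>s\<in>{1..t}. \<omega> (?\<tau> s))"
    using Q \<tau> by (simp add: exchangeable_laws_def)
  then have "word_prob t (x \<circ> inv id) = word_prob t (x \<circ> inv ?\<tau>)"
    using law[OF permutes_id] law[OF \<tau>] by (simp add: id_def)
  then show ?thesis
    using permutes_inv_inv[OF \<sigma>] by simp
qed

sublocale weights: exchangeable_weights word_prob
proof
  show "word_prob t x \<ge> 0" for t x by (simp add: word_prob_def)
  show "determined t (word_prob t)" for t
  proof (rule determinedI)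
    fix x y :: "nat \<Rightarrow> bool"
    assume "\<And>s. s \<in> {1..t} \<Longrightarrow> x s = y s"
    then have "cylinder t x = cylinder t y" by (auto simp: cylinder_def)
    then show "word_prob t x = word_prob t y" by (simp add: word_prob_def)
  qed
  show "word_prob 0 x = 1" for x
    by (simp add: word_prob_def cylinder_def prob_space flip: space_Q)
  show "word_prob t x = word_prob (Suc t) (x(Suc t := True)) + word_prob (Suc t) (x(Suc t := False))" for t x
  proof -
    have step: "cylinder (Suc t) (x(Suc t := b)) = {\<omega> \<in> cylinder t x. \<omega> (Suc t) = b}" for b
    proof -
      have upd: "(\<forall>s\<in>{1..Suc t}. \<omega> s = (x(Suc t := b)) s) \<longleftrightarrow> (\<forall>s\<in>{1..t}. \<omega> s = x s) \<and> \<omega> (Suc t) = b" for \<omega>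
      proof (rule iffI)
        assume eq: "\<forall>s\<in>{1..Suc t}. \<omega> s = (x(Suc t := b)) s"
        have "\<omega> s = x s" if "s \<in> {1..t}" for s
          using bspec[OF eq, of s] that by simp
        moreover have "\<omega> (Suc t) = b" using bspec[OF eq, of "Suc t"] by simp
        ultimately show "(\<forall>s\<in>{1..t}. \<omega> s = x s) \<and> \<omega> (Suc t) = b" by blast
      next
        assume eq: "(\<forall>s\<in>{1..t}. \<omega> s = x s) \<and> \<omega> (Suc t) = b"
        show "\<forall>s\<in>{1..Suc t}. \<omega> s = (x(Suc t := b)) s"
        proof
          fix s assume "s \<in> {1..Suc t}"
          then show "\<omega> s = (x(Suc t := b)) s" using eq by (cases "s = Suc t") auto
        qed
      qed
      show ?thesis
        by (rule set_eqI) (simp only: cylinder_def mem_Collect_eq upd conj_assoc)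
    qed
    have "cylinder t x = cylinder (Suc t) (x(Suc t := True)) \<union> cylinder (Suc t) (x(Suc t := False))"
      and "cylinder (Suc t) (x(Suc t := True)) \<inter> cylinder (Suc t) (x(Suc t := False)) = {}"
      unfolding step by auto
    then show ?thesis
      unfolding word_prob_def by (simp add: finite_measure_Union)
  qed
qed (rule word_prob_perm)

lemma nn_integral_determined:
  fixes h :: "(nat \<Rightarrow> bool) \<Rightarrow> real"
  assumes "determined t h" "\<And>x. h x \<ge> 0"
  shows "(\<integral>\<^sup>+ \<omega>. ennreal (h \<omega>) \<partial>Q) = ennreal (weights.expect t h)"
proof -
  have "(\<integral>\<^sup>+ \<omega>. ennreal (h \<omega>) \<partial>Q) = (\<integral>\<^sup>+ \<omega>. (\<Sum>x\<in>words t. ennreal (h x) * indicator (cylinder t x) \<omega>) \<partial>Q)"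
  proof (rule nn_integral_cong)
    fix \<omega> assume "\<omega> \<in> space Q"
    then have "h \<omega> = (\<Sum>x\<in>words t. h x * indicator (cylinder t x) \<omega>)"
      by (intro determined_eq_sum_cylinder[OF assms(1)]) (simp add: space_Q)
    also have "ennreal \<dots> = (\<Sum>x\<in>words t. ennreal (h x * indicator (cylinder t x) \<omega>))"
      using assms(2) by (intro sum_ennreal[symmetric]) simp
    finally show "ennreal (h \<omega>) = (\<Sum>x\<in>words t. ennreal (h x) * indicator (cylinder t x) \<omega>)"
      using assms(2) by (simp add: ennreal_mult' ennreal_indicator)
  qed
  also have "\<dots> = (\<Sum>x\<in>words t. ennreal (h x) * emeasure Q (cylinder t x))"
  proof (subst nn_integral_sum)
    show "(\<lambda>\<omega>. ennreal (h x) * indicator (cylinder t x) \<omega>) \<in> borel_measurable Q" for x by measurable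
  qed (simp only: nn_integral_cmult_indicator cylinder_event)
  also have "\<dots> = (\<Sum>x\<in>words t. ennreal (word_prob t x * h x))"
    using assms(2) by (simp add: word_prob_def emeasure_eq_measure ennreal_mult' mult.commute)
  also have "\<dots> = ennreal (weights.expect t h)"
    unfolding weights.expect_def using assms(2) by (intro sum_ennreal) (simp add: weights.nonneg)
  finally show ?thesis .
qed

lemma determined_measurable_Q:
  fixes h :: "(nat \<Rightarrow> bool) \<Rightarrow> real"
  shows "determined t h \<Longrightarrow> h \<in> borel_measurable Q"
  using determined_measurable(2) by (simp add: measurable_cong_sets[OF sets_Q refl])

lemma R_measurable [measurable]: "R t \<in> borel_measurable Q"
  by (rule determined_measurable_Q[OF determined_R])

text \<open>Reaching \<epsilon> infinitely often entails reaching it after any given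
  \<open>T\<close>. For each \<delta> one \<open>T\<close> serves all finite horizons, so continuity
  from below extends the bound to the infinite horizon, and \<delta> is arbitrary.\<close>

lemma AE_eventually_R_less:
  assumes \<epsilon>: "\<epsilon> > 0"
  shows "AE x in Q. \<exists>T. \<forall>t\<ge>T. R t x < \<epsilon>"
proof (rule AE_I)
  let ?N = "{x \<in> space Q. \<forall>T. \<exists>t\<ge>T. \<epsilon> \<le> R t x}"
  show "{x \<in> space Q. \<not> (\<exists>T. \<forall>t\<ge>T. R t x < \<epsilon>)} \<subseteq> ?N" by (auto simp: not_less)
  show "?N \<in> events" by measurable
  have "emeasure Q ?N \<le> 0 + ennreal \<delta>" if \<delta>: "\<delta> > 0" for \<delta>
  proof -
    obtain T where T: "\<And>N. N \<ge> T \<Longrightarrow> weights.expect N (\<lambda>x. of_bool (\<exists>t\<in>{T..N}. \<epsilon> \<le> R t x)) \<le> \<delta>"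
      using weights.expect_R_exceeds[OF \<epsilon> \<delta>] by blast
    let ?E = "\<lambda>n. {x \<in> space Q. \<exists>t\<in>{T..T + n}. \<epsilon> \<le> R t x}"
    have E: "emeasure Q (?E n) \<le> ennreal \<delta>" for n
    proof -
      let ?h = "\<lambda>x. of_bool (\<exists>t\<in>{T..T + n}. \<epsilon> \<le> R t x) :: real"
      have det: "determined (T + n) ?h"
      proof (rule determinedI)
        fix x y :: "nat \<Rightarrow> bool"
        assume eq: "\<And>s. s \<in> {1..T + n} \<Longrightarrow> x s = y s"
        have "R t x = R t y" if "t \<in> {T..T + n}" for t
          using eq that by (intro determinedD[OF determined_mono[OF determined_R, of t "T + n"]]) auto
        then show "?h x = ?h y" by simp
      qed
      have "emeasure Q (?E n) = (\<integral>\<^sup>+ x. indicator (?E n) x \<partial>Q)"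
        by (rule nn_integral_indicator[symmetric]) measurable
      also have "\<dots> = (\<integral>\<^sup>+ x. ennreal (?h x) \<partial>Q)"
        by (intro nn_integral_cong) (simp add: indicator_def)
      also have "\<dots> = ennreal (weights.expect (T + n) ?h)"
        by (rule nn_integral_determined[OF det]) simp
      also have "\<dots> \<le> ennreal \<delta>" by (intro ennreal_leI T) simp
      finally show ?thesis .
    qed
    have "emeasure Q ?N \<le> emeasure Q (\<Union>n. ?E n)"
    proof (rule emeasure_mono)
      show "?N \<subseteq> (\<Union>n. ?E n)"
      proof
        fix x assume x: "x \<in> ?N"
        then obtain t where "t \<ge> T" "\<epsilon> \<le> R t x" by auto
        then have "x \<in> ?E (t - T)" using x by auto
        then show "x \<in> (\<Union>n. ?E n)" by blast
      qed
      show "(\<Union>n. ?E n) \<in> events" by measurable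
    qed
    also have "\<dots> = (SUP n. emeasure Q (?E n))"
    proof (rule SUP_emeasure_incseq[symmetric])
      show "range ?E \<subseteq> events" by (rule image_subsetI) measurable
      show "incseq ?E"
        by (rule incseq_SucI) auto
    qed
    also have "\<dots> \<le> ennreal \<delta>" by (rule SUP_least) (rule E)
    finally show ?thesis by simp
  qed
  then have "emeasure Q ?N \<le> 0" by (rule ennreal_le_epsilon)
  then show "emeasure Q ?N = 0" by simp
qed

lemma AE_R_tendsto_0: "AE x in Q. (\<lambda>t. R t x) \<longlonglongrightarrow> 0"
proof -
  have "AE x in Q. \<forall>k. \<exists>T. \<forall>t\<ge>T. R t x < 1 / real (Suc k)"
    unfolding AE_all_countable by (intro allI AE_eventually_R_less) simp
  then show ?thesis
  proof eventually_elim
    case (elim x)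
    show ?case
    proof (rule LIMSEQ_I)
      fix r :: real assume "0 < r"
      then obtain k where k: "1 / real (Suc k) < r" using nat_approx_posE by blast
      obtain T where "\<forall>t\<ge>T. R t x < 1 / real (Suc k)" using elim by blast
      then have "\<forall>t\<ge>T. norm (R t x - 0) < r"
        using k R_pos[of _ x] by (auto simp: abs_of_pos intro: less_trans)
      then show "\<exists>T. \<forall>t\<ge>T. norm (R t x - 0) < r" by blast
    qed
  qed
qed

text \<open>The events \<tau> = t are disjoint and settled by the first t symbols, so
  \<open>weights.expect_R_stopped\<close> bounds every partial sum over t by the total Markov mass
  1.\<close>

lemma stopped_R_le_1:
  assumes \<tau>: "stopping_time nat_filt \<tau>"
  shows "(\<integral>\<^sup>+ \<omega>. stopped R \<tau> \<omega> \<partial>Q) \<le> 1"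
proof -
  \<comment> \<open>The stopping time is constrained only on \<open>space seq_space\<close>, whereas
    \<open>determined\<close> speaks of all functions; restricting to the indices from 1 on moves
    every argument into that space.\<close>
  define B where "B t x \<longleftrightarrow> \<tau> (restrict x {1..}) = enat t" for t x
  have B_space: "B t \<omega> \<longleftrightarrow> \<tau> \<omega> = enat t" if "\<omega> \<in> space seq_space" for t \<omega>
  proof -
    have "restrict \<omega> {1..} = \<omega>" using that by (simp add: space_seq_space)
    then show ?thesis by (simp add: B_def)
  qed
  have det: "determined t (B t)" for t
  proof (rule determinedI)
    fix x y :: "nat \<Rightarrow> bool"
    assume eq: "\<And>s. s \<in> {1..t} \<Longrightarrow> x s = y s"
    let ?x = "restrict x {1..}" and ?y = "restrict y {1..}"
    have space: "?x \<in> space seq_space" "?y \<in> space seq_space" by (auto simp: space_seq_space)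
    have "\<tau> ?x \<le> enat n \<longleftrightarrow> \<tau> ?y \<le> enat n" if "n \<le> t" for n
    proof -
      have "{\<omega> \<in> space seq_space. \<tau> \<omega> \<le> enat n} \<in> sets (nat_filt (enat n))"
        using stopping_timeD[OF \<tau>, of "enat n"] by (simp add: pred_def)
      from nat_filt_coordinates[OF this space] show ?thesis
        using eq that space by simp
    qed
    moreover have "\<tau> \<omega> = enat t \<longleftrightarrow> \<tau> \<omega> \<le> enat t \<and> (\<forall>n<t. \<not> \<tau> \<omega> \<le> enat n)" for \<omega>
      by (cases "\<tau> \<omega>") (auto simp: not_le intro: le_antisym, meson le_neq_implies_less order_refl leD)
    ultimately show "B t x = B t y" by (simp add: B_def)
  qed
  let ?f = "\<lambda>t \<omega>. R t \<omega> * of_bool (B t \<omega>)"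
  have det_f: "determined t (?f t)" for t
    by (rule determined_comp2[where H = "\<lambda>r b. r * of_bool b", OF determined_R det])
  have "(\<integral>\<^sup>+ \<omega>. stopped R \<tau> \<omega> \<partial>Q) \<le> (\<integral>\<^sup>+ \<omega>. (\<Sum>t. ennreal (?f t \<omega>)) \<partial>Q)"
  proof (rule nn_integral_mono_AE)
    show "AE \<omega> in Q. stopped R \<tau> \<omega> \<le> (\<Sum>t. ennreal (?f t \<omega>))"
      using AE_R_tendsto_0 AE_space
    proof eventually_elim
      case (elim \<omega>)
      show ?case
      proof (cases "\<tau> \<omega>")
        case (enat t)
        then have "B t \<omega>" using B_space elim(2) by (simp add: space_Q)
        then have "stopped R \<tau> \<omega> = ennreal (?f t \<omega>)" using enat by (simp add: stopped_def)
        also have "\<dots> = (\<Sum>s\<in>{t}. ennreal (?f s \<omega>))" by simp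
        also have "\<dots> \<le> (\<Sum>s. ennreal (?f s \<omega>))" by (intro sum_le_suminf) auto
        finally show ?thesis .
      next
        case infinity
        have "(\<lambda>t. ennreal (R t \<omega>)) \<longlonglongrightarrow> ennreal 0" using elim(1) by (rule tendsto_ennrealI)
        then have "limsup (\<lambda>t. ennreal (R t \<omega>)) = 0" by (simp add: lim_imp_Limsup)
        then show ?thesis using infinity by (simp add: stopped_def)
      qed
    qed
  qed
  also have "\<dots> = (\<Sum>t. \<integral>\<^sup>+ \<omega>. ennreal (?f t \<omega>) \<partial>Q)"
    by (intro nn_integral_suminf measurable_compose[OF determined_measurable_Q[OF det_f] measurable_ennreal])
  also have "\<dots> = (\<Sum>t. ennreal (weights.expect t (?f t)))"
    using R_pos by (intro suminf_cong nn_integral_determined det_f) (simp add: less_imp_le)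
  also have "\<dots> \<le> 1"
  proof (rule suminf_le_const)
    show "(\<Sum>t<n. ennreal (weights.expect t (?f t))) \<le> 1" for n
    proof -
      have nonneg: "weights.expect t (?f t) \<ge> 0" for t
        unfolding weights.expect_def using R_pos weights.nonneg
        by (intro sum_nonneg mult_nonneg_nonneg) (auto simp: less_imp_le)
      have "(\<Sum>t<n. weights.expect t (?f t)) \<le> (\<Sum>t\<in>{0..n}. weights.expect t (?f t))"
        using nonneg by (intro sum_mono2) auto
      also have "\<dots> \<le> markov_mix.expect n (\<lambda>x. of_bool (\<exists>t\<in>{0..n}. B t x))"
        by (rule weights.expect_R_stopped[OF det]) (simp add: B_def)
      also have "\<dots> \<le> markov_mix.expect n (\<lambda>_. 1)"
        by (rule markov_mix.expect_mono) simp
      finally have "(\<Sum>t<n. weights.expect t (?f t)) \<le> 1" by (simp add: markov_mix.expect_one)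
      then show ?thesis using nonneg by simp
    qed
  qed simp
  finally show ?thesis .
qed

end

theorem theorem7:
  shows "(\<forall>(x :: nat \<Rightarrow> bool) (\<alpha> :: real) (\<beta> :: real) (\<gamma> :: real) (p :: real).
      (\<lambda>t. real (trans_count True True t x) / real t) \<longlonglongrightarrow> \<alpha> \<longrightarrow>
      (\<lambda>t. real (trans_count False False t x) / real t) \<longlonglongrightarrow> \<beta> \<longrightarrow>
      (\<lambda>t. real (trans_count True False t x) / real t) \<longlonglongrightarrow> \<gamma> \<longrightarrow>
      (\<lambda>t. real (symbol_count True t x) / real t) \<longlonglongrightarrow> p \<longrightarrow>
        (\<lambda>t. real (trans_count False True t x) / real t) \<longlonglongrightarrow> \<gamma> \<and>
        (\<lambda>t. real (trans_count True True t x + trans_count False True t x) / real t) \<longlonglongrightarrow> p \<and>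
        (\<lambda>t. ln (R t x) / real t) \<longlonglongrightarrow> rstar \<alpha> \<beta> \<gamma> p \<and>
        rstar \<alpha> \<beta> \<gamma> p =
          \<gamma> * ln (ratio \<gamma> (1 - p)) + \<beta> * ln (ratio \<beta> (1 - p))
          + \<alpha> * ln (ratio \<alpha> p) + \<gamma> * ln (ratio \<gamma> p) - p * ln p - (1 - p) * ln (1 - p) \<and>
        rstar \<alpha> \<beta> \<gamma> p =
          bernoulli_entropy p - p * bernoulli_entropy (ratio \<alpha> p)
          - (1 - p) * bernoulli_entropy (ratio \<gamma> (1 - p)) \<and>
        (\<alpha> * (1 - p) \<noteq> \<gamma> * p \<longrightarrow>
          rstar \<alpha> \<beta> \<gamma> p > 0 \<and>
          filterlim (\<lambda>t. R t x) at_top sequentially \<and>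
          (\<exists>c>0. \<forall>\<^sub>F t in sequentially. exp (c * real t) \<le> R t x)) \<and>
        (rstar \<alpha> \<beta> \<gamma> p = 0 \<longleftrightarrow> \<alpha> * (1 - p) = \<gamma> * p)) \<and>
    (\<forall>Q\<in>exchangeable_laws. AE x in Q. (\<lambda>t. R t x) \<longlonglongrightarrow> 0) \<and>
    safe_e_process exchangeable_laws R"
proof (intro conjI allI impI ballI)
  fix x :: "nat \<Rightarrow> bool" and \<alpha> \<beta> \<gamma> p :: real
  assume lims: "(\<lambda>t. real (trans_count True True t x) / real t) \<longlonglongrightarrow> \<alpha>"
    "(\<lambda>t. real (trans_count False False t x) / real t) \<longlonglongrightarrow> \<beta>"
    "(\<lambda>t. real (trans_count True False t x) / real t) \<longlonglongrightarrow> \<gamma>"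
    "(\<lambda>t. real (symbol_count True t x) / real t) \<longlonglongrightarrow> p"
  note rel = limit_relations[OF lims]
  note forms = rstar_eq_mutual_info[OF rel]
  note sign = mutual_info_sign[OF rel]
  show "(\<lambda>t. real (trans_count False True t x) / real t) \<longlonglongrightarrow> \<gamma>"
    by (rule trans_limit_01[OF lims])
  show "(\<lambda>t. real (trans_count True True t x + trans_count False True t x) / real t) \<longlonglongrightarrow> p"
    by (rule trans_limit_1[OF lims])
  show "(\<lambda>t. ln (R t x) / real t) \<longlonglongrightarrow> rstar \<alpha> \<beta> \<gamma> p"
    unfolding forms(1) by (rule ln_R_rate[OF lims])
  show "rstar \<alpha> \<beta> \<gamma> p = \<gamma> * ln (ratio \<gamma> (1 - p)) + \<beta> * ln (ratio \<beta> (1 - p))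
          + \<alpha> * ln (ratio \<alpha> p) + \<gamma> * ln (ratio \<gamma> p) - p * ln p - (1 - p) * ln (1 - p)"
    unfolding forms(1,2) ..
  show "rstar \<alpha> \<beta> \<gamma> p = bernoulli_entropy p - p * bernoulli_entropy (ratio \<alpha> p)
          - (1 - p) * bernoulli_entropy (ratio \<gamma> (1 - p))"
    unfolding forms(1,3) ..
  show "rstar \<alpha> \<beta> \<gamma> p = 0 \<longleftrightarrow> \<alpha> * (1 - p) = \<gamma> * p"
    unfolding forms(1) by (rule sign(2))
  assume "\<alpha> * (1 - p) \<noteq> \<gamma> * p"
  then have pos: "mutual_info \<alpha> \<beta> \<gamma> p > 0" using sign by linarith
  then show "rstar \<alpha> \<beta> \<gamma> p > 0" by (simp only: forms(1))
  show "filterlim (\<lambda>t. R t x) at_top sequentially"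
    by (rule R_exponential_growth(1)[OF lims pos])
  show "\<exists>c>0. \<forall>\<^sub>F t in sequentially. exp (c * real t) \<le> R t x"
    by (rule R_exponential_growth(2)[OF lims pos])
next
  fix Q assume "Q \<in> exchangeable_laws"
  then interpret exchangeable_law Q by unfold_locales
  show "AE x in Q. (\<lambda>t. R t x) \<longlonglongrightarrow> 0" by (rule AE_R_tendsto_0)
next
  have "(SUP Q\<in>exchangeable_laws. SUP \<tau>\<in>{\<tau>. stopping_time nat_filt \<tau>}. \<integral>\<^sup>+ \<omega>. stopped R \<tau> \<omega> \<partial>Q) \<le> 1"
  proof (intro SUP_least)
    fix Q \<tau> assume "Q \<in> exchangeable_laws" and \<tau>: "\<tau> \<in> {\<tau>. stopping_time nat_filt \<tau>}"
    then interpret exchangeable_law Q by unfold_locales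
    show "(\<integral>\<^sup>+ \<omega>. stopped R \<tau> \<omega> \<partial>Q) \<le> 1" using \<tau> by (intro stopped_R_le_1) simp
  qed
  then show "safe_e_process exchangeable_laws R"
    using R_pos determined_measurable(1)[OF determined_R]
    by (auto simp: safe_e_process_def less_imp_le)
qed

end
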